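(* Let $p$ be an odd prime and $m$ a positive integer, let $q$ be an indeterminate, and put $[p]=1+q+\cdots+q^{p-1}$. Then $$ \sum_{k=0}^{p-1}\frac{1-q^{2k+1}}{1-q}D_q(m,k)\, D_{q^{-1}}(m,k)\, q^{-k} \equiv\begin{cases} \dfrac{1-q^{-2m}}{1-q^2}\,q\pmod{[p]^2}&\text{if } m\equiv 0\pmod{p}, \\[10pt] \dfrac{1-q^{2m+2}}{1-q^2}\,q\pmod{[p]^2}&\text{if } m\equiv -1\pmod{p}, \\[10pt] 0\pmod{[p]^2}&\text{otherwise}. \end{cases} $$ Here both sides are Laurent polynomials in $q$ with integer coefficients, and $A\equiv B\pmod{[p]^2}$ means that $A-B$ is divisible by $[p]^2$ in $\mathbb{Z}[q,q^{-1}]$ (equivalently, after multiplying $A-B$ by a sufficiently large power of $q$, it is divisible by $[p]^2$ in $\mathbb{Z}[q]$).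
   Context: The $q$-shifted factorial is $(a;q)_0=1$ and $(a;q)_k=(1-a)(1-aq)\cdots(1-aq^{k-1})$ for $k\geq 1$. The $q$-binomial coefficient is ${n\brack k}=\frac{(q;q)_n}{(q;q)_k(q;q)_{n-k}}$ if $n\ge k\ge 0$, and ${n\brack k}=0$ otherwise. The $q$-Delannoy numbers are $$ D_q(m,n)=\sum_{k=0}^{n}q^{\binom{k}{2}}{n\brack k}{n+m-k\brack n}\qquad (m,n\ge 0), $$ a polynomial in $q$ with integer coefficients, and $D_{q^{-1}}(m,n)$ denotes the Laurent polynomial obtained from it by replacing $q$ by $q^{-1}$. *)

theory Defs
  imports
    "HOL-Computational_Algebra.Computational_Algebra"
    "HOL-Number_Theory.Cong"
begin

text \<open>
  The formulas below are written for an element \<open>a\<close>, \<open>x\<close> of an arbitrary field, so that they can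
  be read both at the indeterminate \<open>q\<close> and at \<open>1/q\<close>. The ambient field is
  the fraction field of \<open>\<int>[q]\<close>. There \<open>q\<close> and \<open>1/q\<close> are not roots of unity, so all the
  quotients below are genuine ones, and evaluating a formula at \<open>1/q\<close> agrees with
  replacing \<open>q\<close> by \<open>1/q\<close> in the polynomial that the formula represents.
\<close>

definition qpochhammer :: "'a::field \<Rightarrow> 'a \<Rightarrow> nat \<Rightarrow> 'a" where
  "qpochhammer a x k = (\<Prod>i<k. 1 - a * x ^ i)"

definition qbinomial :: "'a::field \<Rightarrow> nat \<Rightarrow> nat \<Rightarrow> 'a" where
  "qbinomial x n k =
    (if k \<le> n then qpochhammer x x n / (qpochhammer x x k * qpochhammer x x (n - k)) else 0)"

text \<open>The subtraction in \<open>n + m - k\<close> does not truncate, since \<open>k \<le> n\<close>.\<close>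

definition qdelannoy :: "'a::field \<Rightarrow> nat \<Rightarrow> nat \<Rightarrow> 'a" where
  "qdelannoy x m n = (\<Sum>k=0..n. x ^ (k choose 2) * qbinomial x n k * qbinomial x (n + m - k) n)"

definition qint :: "'a::field \<Rightarrow> nat \<Rightarrow> 'a" where
  "qint x n = (\<Sum>i<n. x ^ i)"

definition qvar :: "int poly fract" where
  "qvar = to_fract [:0, 1:]"

text \<open>The ring \<open>\<int>[q, 1/q]\<close> as a subset of the fraction field of \<open>\<int>[q]\<close>.\<close>

definition laurent_polys :: "int poly fract set" where
  "laurent_polys = {to_fract f / qvar ^ n | f n. True}"

text \<open>
  Congruence in \<open>\<int>[q, 1/q]\<close>. It includes that both sides are Laurent polynomials, and the
  quotient has to be one as well (divisibility in the ambient field would be trivial).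
\<close>

definition laurent_cong :: "int poly fract \<Rightarrow> int poly fract \<Rightarrow> int poly fract \<Rightarrow> bool" where
  "laurent_cong A B M \<longleftrightarrow>
    A \<in> laurent_polys \<and> B \<in> laurent_polys \<and> (\<exists>L\<in>laurent_polys. A - B = M * L)"

end

theory Submission
  imports Defs
begin

text \<open>
  The proof rests on an expansion of the product \<open>D\<^sub>q(m,n) D\<^bsub>1/q\<^esub>(m,n)\<close> that separates the
  variables \<open>m\<close> and \<open>n\<close> (\<open>delannoy_product_expansion\<close>):
  \<open>D\<^sub>q(m,n) D\<^bsub>1/q\<^esub>(m,n) = (\<Sum>k\<le>n. c\<^sub>k S\<^sub>k(q^m) S\<^sub>k(q^n))\<close>, where
  \<open>S\<^sub>k(y) = (\<Prod>j<k. (1 - y q^(j+1)) (1 - y/q^j) / y)\<close> is invariant under \<open>y \<mapsto> 1/(q y)\<close>, that is,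
  under \<open>n \<mapsto> -1-n\<close>. It is a \<open>q\<close>-analogue of the square formula
  \<open>D(m,n)^2 = (\<Sum>k. (m+k choose 2k) (n+k choose 2k) (2k choose k) 4^k)\<close>. The product and every
  term \<open>S\<^sub>k(q^m) S\<^sub>k(q^n)\<close> satisfy one and the same linear relation between the four corners of a
  unit square of the \<open>(m,n)\<close> grid. By induction on \<open>n\<close> this relation forces the difference of
  the two sides to be \<open>C S\<^sub>n(q^m)\<close> for a constant \<open>C\<close>; multiplying by \<open>y^n\<close> with \<open>y = q^m\<close> and
  comparing constant terms of the resulting polynomials in \<open>y\<close> gives \<open>C = 0\<close>, since the
  \<open>q\<close>-binomial theorem evaluates the constant terms of both factors.

  The weight \<open>(1 - q^(2n+1)) q^(-n)\<close> is such that its product with \<open>S\<^sub>k(q^n)\<close> has a closed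
  antidifference in \<open>n\<close>. Summing over \<open>n < p\<close> therefore turns the left-hand side into
  \<open>\<Sum>k<p. u\<^sub>k [p] [p choose k+1]\<close> with Laurent polynomials \<open>u\<^sub>k\<close> (\<open>weighted_delannoy_sum\<close>). As
  \<open>[p]\<close> divides the \<open>q\<close>-binomial coefficient \<open>[p choose k+1]\<close> for \<open>k + 1 < p\<close>, only the summand
  \<open>k = p - 1\<close> survives modulo \<open>[p]^2\<close>. It is \<open>[p] u\<close> with \<open>u = u\<^bsub>p-1\<^esub>\<close>, so that \<open>u\<close> matters only
  modulo \<open>[p]\<close>. There \<open>q^p\<close> becomes \<open>1\<close>, and the \<open>q\<close>-Lucas theorem evaluates the factor
  \<open>[m+p-1 choose 2p-2]\<close> of \<open>u\<close>: it vanishes unless \<open>m\<close> is \<open>0\<close> or \<open>-1\<close> modulo \<open>p\<close>, which are the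
  three cases of the theorem.
\<close>

section \<open>The q-binomial theorem\<close>

lemma qpochhammer_0 [simp]: "qpochhammer a x 0 = 1"
  by (simp add: qpochhammer_def)

lemma qpochhammer_Suc: "qpochhammer a x (Suc k) = qpochhammer a x k * (1 - a * x ^ k)"
  by (simp add: qpochhammer_def)

text \<open>
  The identities are proved over any field, for any nonzero base that is not a root of unity.
  The hypotheses pass from \<open>q\<close> to \<open>1/q\<close>, so each fact on \<open>D\<^sub>q\<close> is available for \<open>D\<^bsub>1/q\<^esub>\<close> as well.
\<close>

locale generic_base =
  fixes q :: "'a::field"
  assumes q_nonzero [simp]: "q \<noteq> 0"
    and q_power_neq_1 [simp]: "0 < i \<Longrightarrow> q ^ i \<noteq> 1"
begin

lemma q_neq_1 [simp]: "q \<noteq> 1"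
  using q_power_neq_1[of 1] by simp

lemma q_power_eq_iff [simp]: "q ^ i = q ^ j \<longleftrightarrow> i = j"
proof -
  have *: "q ^ i \<noteq> q ^ j" if "i < j" for i j
  proof
    assume "q ^ i = q ^ j"
    also have "q ^ j = q ^ i * q ^ (j - i)" using that by (simp flip: power_add)
    finally show False using that q_power_neq_1[of "j - i"] by simp
  qed
  show ?thesis using *[of i j] *[of j i] by (cases i j rule: linorder_cases) auto
qed

lemma qpochhammer_Suc_q: "qpochhammer q q (Suc k) = qpochhammer q q k * (1 - q ^ Suc k)"
  by (simp add: qpochhammer_Suc)

lemma one_minus_q_power_nonzero: "1 - q ^ Suc k \<noteq> 0"
  using q_power_neq_1[of "Suc k"] by (metis right_minus_eq zero_less_Suc)

lemma qpochhammer_nonzero [simp]: "qpochhammer q q k \<noteq> 0"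
  by (induction k) (use one_minus_q_power_nonzero in \<open>auto simp: qpochhammer_Suc_q\<close>)

lemma qbinomial_0_right [simp]: "qbinomial q n 0 = 1"
  by (simp add: qbinomial_def)

lemma qbinomial_self [simp]: "qbinomial q n n = 1"
  by (simp add: qbinomial_def)

lemma qbinomial_eq_0 [simp]: "n < k \<Longrightarrow> qbinomial q n k = 0"
  by (simp add: qbinomial_def)

lemma qbinomial_Suc_Suc:
  "qbinomial q (Suc n) (Suc k) = qbinomial q n k + q ^ Suc k * qbinomial q n (Suc k)"
proof (cases n k rule: linorder_cases)
  case greater
  then obtain j where n: "n = Suc (k + j)" by (metis less_iff_Suc_add)
  have "qbinomial q n k = qpochhammer q q n / (qpochhammer q q k * qpochhammer q q (Suc j))"
    "qbinomial q n (Suc k) = qpochhammer q q n / (qpochhammer q q (Suc k) * qpochhammer q q j)"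
    "qbinomial q (Suc n) (Suc k) =
       qpochhammer q q (Suc n) / (qpochhammer q q (Suc k) * qpochhammer q q (Suc j))"
    by (simp_all add: qbinomial_def n)
  moreover have "q ^ Suc n = q ^ Suc k * q ^ Suc j" by (simp add: n power_add)
  ultimately show ?thesis
    using one_minus_q_power_nonzero[of k] one_minus_q_power_nonzero[of j]
    by (simp only: qpochhammer_Suc_q) (simp add: divide_simps, simp add: algebra_simps)
qed auto

lemma qbinomial_symmetric: "k \<le> n \<Longrightarrow> qbinomial q n (n - k) = qbinomial q n k"
  by (simp add: qbinomial_def mult.commute)

lemma qbinomial_Suc_Suc':
  assumes "k \<le> n"
  shows "qbinomial q (Suc n) (Suc k) = q ^ (n - k) * qbinomial q n k + qbinomial q n (Suc k)"
proof (cases "k = n")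
  case False
  with assms obtain j where n: "n = Suc (k + j)" by (metis less_iff_Suc_add nat_less_le)
  have "qbinomial q (Suc n) (Suc k) = qbinomial q (Suc n) (Suc j)"
    using qbinomial_symmetric[of "Suc j" "Suc n"] by (simp add: n)
  also have "\<dots> = qbinomial q n j + q ^ Suc j * qbinomial q n (Suc j)"
    by (rule qbinomial_Suc_Suc)
  also have "qbinomial q n j = qbinomial q n (Suc k)"
    using qbinomial_symmetric[of j n] by (simp add: n)
  also have "qbinomial q n (Suc j) = qbinomial q n k"
    using qbinomial_symmetric[of k n] by (simp add: n)
  finally show ?thesis by (simp add: n)
qed simp

text \<open>
  The coefficient of \<open>z^k\<close> in \<open>(\<Prod>i<n. 1 + z q^i)\<close>.
\<close>

definition qprod_coeff :: "nat \<Rightarrow> nat \<Rightarrow> 'a" where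
  "qprod_coeff n k = q ^ (k choose 2) * qbinomial q n k"

lemma choose_2_Suc: "Suc k choose 2 = (k choose 2) + k"
  by (simp add: numeral_2_eq_2)

lemma qprod_coeff_0_right [simp]: "qprod_coeff n 0 = 1"
  by (simp add: qprod_coeff_def numeral_2_eq_2)

lemma qprod_coeff_Suc: "qprod_coeff (Suc n) (Suc k) =
    qprod_coeff n (Suc k) + q ^ n * qprod_coeff n k"
proof (cases "k \<le> n")
  case True
  have "q ^ n = q ^ k * q ^ (n - k)" using True by (simp flip: power_add)
  then show ?thesis unfolding qprod_coeff_def qbinomial_Suc_Suc'[OF True] choose_2_Suc
    by (simp add: power_add algebra_simps)
qed (auto simp: qprod_coeff_def)

lemma q_binomial_theorem: "(\<Sum>k\<le>n. qprod_coeff n k * z ^ k) = (\<Prod>i<n. 1 + z * q ^ i)"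
proof (induction n)
  case 0
  show ?case by simp
next
  case (Suc n)
  have "(\<Sum>k\<le>Suc n. qprod_coeff (Suc n) k * z ^ k) =
        1 + (\<Sum>k\<le>n. qprod_coeff n (Suc k) * z ^ Suc k) + q ^ n * z * (\<Sum>k\<le>n. qprod_coeff n k * z ^ k)"
    by (simp only: sum.atMost_Suc_shift qprod_coeff_Suc)
       (simp add: sum.distrib sum_distrib_left algebra_simps)
  also have "1 + (\<Sum>k\<le>n. qprod_coeff n (Suc k) * z ^ Suc k) = (\<Sum>k\<le>Suc n. qprod_coeff n k * z ^ k)"
    by (simp only: sum.atMost_Suc_shift) simp
  also have "\<dots> = (\<Sum>k\<le>n. qprod_coeff n k * z ^ k)" by (simp add: qprod_coeff_def)
  finally show ?case unfolding Suc prod.lessThan_Suc by (simp add: algebra_simps)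
qed

section \<open>Recurrences of the q-Delannoy numbers\<close>

text \<open>
  The generating function of \<open>D\<^sub>q(m,n)\<close> in \<open>m\<close> is
  \<open>F\<^sub>n(z) = (\<Prod>i<n. 1 + z q^i) / (\<Prod>i\<le>n. 1 - z q^i)\<close>; the two series are its numerator and the
  reciprocal of its denominator.
\<close>

definition qprod_series :: "nat \<Rightarrow> 'a fps" where "qprod_series n = Abs_fps (qprod_coeff n)"
definition qrecip_series :: "nat \<Rightarrow> 'a fps"
    where "qrecip_series n = Abs_fps (\<lambda>j. qbinomial q (n + j) n)"

lemma qprod_series_Suc: "qprod_series (Suc n) = (1 + fps_const (q ^ n) * fps_X) * qprod_series n"
proof (rule fps_ext)
  fix k
  show "qprod_series (Suc n) $ k = ((1 + fps_const (q ^ n) * fps_X) * qprod_series n) $ k"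
    by (cases k) (auto simp: qprod_series_def qprod_coeff_Suc distrib_right mult.assoc)
qed

lemma qrecip_series_Suc: "(1 - fps_const (q ^ Suc n) * fps_X) * qrecip_series (Suc n) =
    qrecip_series n"
proof (rule fps_ext)
  fix k
  show "((1 - fps_const (q ^ Suc n) * fps_X) * qrecip_series (Suc n)) $ k = qrecip_series n $ k"
    by (cases k) (auto simp: qrecip_series_def left_diff_distrib mult.assoc qbinomial_Suc_Suc)
qed

lemma qdelannoy_fps: "qdelannoy q m n = (qprod_series n * qrecip_series n) $ m"
proof -
  have "(qprod_series n * qrecip_series n) $ m =
      (\<Sum>k=0..m. qprod_coeff n k * qbinomial q (n + (m - k)) n)"
    by (simp add: fps_mult_nth qprod_series_def qrecip_series_def)
  also have "\<dots> = (\<Sum>k\<in>{0..m}\<inter>{0..n}. qprod_coeff n k * qbinomial q (n + m - k) n)"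
    by (rule sum.mono_neutral_cong_right) (auto simp: qprod_coeff_def)
  also have "\<dots> = (\<Sum>k=0..n. qprod_coeff n k * qbinomial q (n + m - k) n)"
    by (rule sum.mono_neutral_left) auto
  finally show ?thesis by (simp add: qdelannoy_def qprod_coeff_def)
qed

lemma qdelannoy_0_left [simp]: "qdelannoy q 0 n = 1"
  by (simp add: qdelannoy_fps fps_mult_nth qprod_series_def qrecip_series_def)

lemma qdelannoy_0_right [simp]: "qdelannoy q m 0 = 1"
  by (simp add: qdelannoy_def numeral_2_eq_2)

text \<open>
  The functional equation \<open>(1 - q^(n+1) z) F\<^bsub>n+1\<^esub>(z) = (1 + q^n z) F\<^sub>n(z)\<close>, read off
  coefficientwise.
\<close>

lemma qdelannoy_rec1:
  "qdelannoy q (Suc m) (Suc n) - q ^ Suc n * qdelannoy q m (Suc n) =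
   qdelannoy q (Suc m) n + q ^ n * qdelannoy q m n"
proof -
  have "(1 - fps_const (q ^ Suc n) * fps_X) * (qprod_series (Suc n) * qrecip_series (Suc n)) =
        (1 + fps_const (q ^ n) * fps_X) * (qprod_series n * qrecip_series n)" (is "?L = ?R")
    by (metis (no_types, lifting) qprod_series_Suc qrecip_series_Suc mult.assoc mult.left_commute)
  then have "?L $ Suc m = ?R $ Suc m" by simp
  then show ?thesis
    by (simp add: qdelannoy_fps left_diff_distrib distrib_right mult.assoc)
qed

text \<open>
  The substitution \<open>z \<mapsto> q z\<close>.
\<close>

definition qdilate :: "'a fps \<Rightarrow> 'a fps" where "qdilate f = Abs_fps (\<lambda>k. q ^ k * f $ k)"

lemma qdilate_mult: "qdilate (f * g) = qdilate f * qdilate g"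
proof (rule fps_ext)
  fix m
  have "q ^ m * (f $ i * g $ (m - i)) = (q ^ i * f $ i) * (q ^ (m - i) * g $ (m - i))"
    if "i \<le> m" for i
  proof -
    have "q ^ m = q ^ i * q ^ (m - i)" using that by (simp flip: power_add)
    then show ?thesis by simp
  qed
  then show "qdilate (f * g) $ m = (qdilate f * qdilate g) $ m"
    unfolding qdilate_def fps_mult_nth fps_nth_Abs_fps sum_distrib_left by (intro sum.cong) auto
qed

lemma qprod_series_Suc_qdilate: "qprod_series (Suc n) = (1 + fps_X) * qdilate (qprod_series n)"
proof (rule fps_ext)
  fix k
  show "qprod_series (Suc n) $ k = ((1 + fps_X) * qdilate (qprod_series n)) $ k"
    by (cases k) (auto simp: qprod_series_def qdilate_def distrib_right qprod_coeff_def
        qbinomial_Suc_Suc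
        choose_2_Suc power_add algebra_simps)
qed

lemma qrecip_series_Suc_qdilate: "(1 - fps_X) * qrecip_series (Suc n) = qdilate (qrecip_series n)"
proof (rule fps_ext)
  fix k
  show "((1 - fps_X) * qrecip_series (Suc n)) $ k = qdilate (qrecip_series n) $ k"
    by (cases k) (auto simp: qrecip_series_def qdilate_def left_diff_distrib qbinomial_Suc_Suc')
qed

text \<open>
  The functional equation \<open>(1 - z) F\<^bsub>n+1\<^esub>(z) = (1 + z) F\<^sub>n(q z)\<close>, read off coefficientwise.
\<close>

lemma qdelannoy_rec2:
  "qdelannoy q (Suc m) (Suc n) - qdelannoy q m (Suc n) =
   q ^ Suc m * qdelannoy q (Suc m) n + q ^ m * qdelannoy q m n"
proof -
  have "(1 - fps_X) * (qprod_series (Suc n) * qrecip_series (Suc n)) =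
      (1 + fps_X) * qdilate (qprod_series n * qrecip_series n)" (is "?L = ?R")
    by (metis (no_types, lifting) qprod_series_Suc_qdilate qrecip_series_Suc_qdilate qdilate_mult
        mult.assoc mult.left_commute)
  then have "?L $ Suc m = ?R $ Suc m" by simp
  then show ?thesis
    by (simp add: qdelannoy_fps left_diff_distrib distrib_right qdilate_def)
qed

text \<open>
  Solving the two recurrences for the entries of row \<open>n + 1\<close> expresses the pair
  \<open>(D(m+1,n+1), D(m,n+1))\<close> linearly by the pair \<open>(D(m+1,n), D(m,n))\<close>.
\<close>

lemma qdelannoy_step_self:
  "(1 - q ^ Suc n) * qdelannoy q (Suc m) (Suc n) =
   (1 - q ^ Suc n * q ^ Suc m) * qdelannoy q (Suc m) n +
   q ^ n * (1 - q ^ Suc m) * qdelannoy q m n"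
proof -
  have "(1 - q ^ Suc n) * qdelannoy q (Suc m) (Suc n) =
    (qdelannoy q (Suc m) (Suc n) - q ^ Suc n * qdelannoy q m (Suc n))
     - q ^ Suc n * (qdelannoy q (Suc m) (Suc n) - qdelannoy q m (Suc n))"
    by (simp add: algebra_simps)
  then show ?thesis
    unfolding qdelannoy_rec1 qdelannoy_rec2 by (simp add: algebra_simps)
qed

lemma qdelannoy_step_pred:
  "(1 - q ^ Suc n) * qdelannoy q m (Suc n) =
   (1 - q ^ Suc m) * qdelannoy q (Suc m) n + (q ^ n - q ^ m) * qdelannoy q m n"
proof -
  have "(1 - q ^ Suc n) * qdelannoy q m (Suc n) =
    (qdelannoy q (Suc m) (Suc n) - q ^ Suc n * qdelannoy q m (Suc n))
     - (qdelannoy q (Suc m) (Suc n) - qdelannoy q m (Suc n))"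
    by (simp add: algebra_simps)
  then show ?thesis
    unfolding qdelannoy_rec1 qdelannoy_rec2 by (simp add: algebra_simps)
qed

lemma generic_base_inverse: "generic_base (inverse q)"
  by unfold_locales (auto simp: power_inverse)

section \<open>The expansion of the product\<close>

definition delannoy_product :: "nat \<Rightarrow> nat \<Rightarrow> 'a" where
  "delannoy_product m n = qdelannoy q m n * qdelannoy (inverse q) m n"

text \<open>
  Let \<open>a, b\<close> be the entries of row \<open>n\<close> at \<open>m + 1\<close> and \<open>m\<close>, and \<open>a', b'\<close> those for the base
  \<open>1/q\<close>. The products at the two corners in row \<open>n + 1\<close> are quadratic in these, and in both of
  them the mixed terms \<open>a b'\<close> and \<open>b a'\<close> occur in the same ratio. They can thus be eliminated,
  which leaves a relation between the products at the four corners.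
\<close>

lemma delannoy_product_corner:
  "(1 - q ^ Suc n * q ^ Suc m) * (delannoy_product (Suc m) n - delannoy_product m (Suc n)) =
   (q ^ Suc m - q ^ Suc n) * (delannoy_product (Suc m) (Suc n) - delannoy_product m n)"
proof -
  define N M where "N = q ^ n" and "M = q ^ m"
  define a b where "a = qdelannoy q (Suc m) n" and "b = qdelannoy q m n"
  define a' b' where "a' = qdelannoy (inverse q) (Suc m) n" and "b' = qdelannoy (inverse q) m n"
  define d e where "d = qdelannoy q (Suc m) (Suc n)" and "e = qdelannoy q m (Suc n)"
  define d' e' where "d' = qdelannoy (inverse q) (Suc m) (Suc n)"
    and "e' = qdelannoy (inverse q) m (Suc n)"
  have nz: "N \<noteq> 0" "M \<noteq> 0" "1 - q * N \<noteq> 0"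
    using one_minus_q_power_nonzero[of n] by (simp_all add: N_def M_def)
  have d: "(1 - q * N) * d = (1 - q * N * (q * M)) * a + N * (1 - q * M) * b"
    using qdelannoy_step_self[of n m] by (simp add: a_def b_def d_def N_def M_def)
  have e: "(1 - q * N) * e = (1 - q * M) * a + (N - M) * b"
    using qdelannoy_step_pred[of n m] by (simp add: a_def b_def e_def N_def M_def)
  have "(1 - inverse (q * N)) * d' =
      (1 - inverse (q * N) * inverse (q * M)) * a' + inverse N * (1 - inverse (q * M)) * b'"
    using generic_base.qdelannoy_step_self[OF generic_base_inverse, of n m]
    by (simp add: a'_def b'_def d'_def N_def M_def power_inverse)
  note E = this
  have "q * M * (1 - q * N) * d' = - (q * N * q * M) * ((1 - inverse (q * N)) * d')"
    using nz by (simp add: field_simps)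
  also have "\<dots> = (1 - q * N * (q * M)) * a' + q * (1 - q * M) * b'"
    unfolding E using nz by (simp add: field_simps)
  finally have d': "q * M * (1 - q * N) * d' = (1 - q * N * (q * M)) * a' + q * (1 - q * M) * b'" .
  have "(1 - inverse (q * N)) * e' =
      (1 - inverse (q * M)) * a' + (inverse N - inverse M) * b'"
    using generic_base.qdelannoy_step_pred[OF generic_base_inverse, of n m]
    by (simp add: a'_def b'_def e'_def N_def M_def power_inverse)
  note E = this
  have "M * (1 - q * N) * e' = - (q * N * M) * ((1 - inverse (q * N)) * e')"
    using nz by (simp add: field_simps)
  also have "\<dots> = N * (1 - q * M) * a' + q * (N - M) * b'"
    unfolding E using nz by (simp add: field_simps)
  finally have e': "M * (1 - q * N) * e' = N * (1 - q * M) * a' + q * (N - M) * b'" .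
  have "(q * M * (1 - q * N)\<^sup>2) * ((1 - q * N * (q * M)) * (a * a' - e * e')) =
    (1 - q * N * (q * M)) * (q * M * (1 - q * N)\<^sup>2 * a * a' - q * ((1 - q * N) * e) *
        (M * (1 - q * N) * e'))"
    by (simp add: algebra_simps power2_eq_square)
  also have "\<dots> = (q * M - q * N) *
    (((1 - q * N) * d) * (q * M * (1 - q * N) * d') - q * M * (1 - q * N)\<^sup>2 * b * b')"
    unfolding d e d' e' by algebra
  also have "\<dots> = (q * M * (1 - q * N)\<^sup>2) * ((q * M - q * N) * (d * d' - b * b'))"
    by (simp add: algebra_simps power2_eq_square)
  finally have "(1 - q * N * (q * M)) * (a * a' - e * e') = (q * M - q * N) * (d * d' - b * b')"
    using nz by simp
  then show ?thesis
    by (simp add: delannoy_product_def a_def b_def a'_def b'_def d_def e_def d'_def e'_def N_def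
        M_def)
qed

text \<open>
  The functions \<open>S\<^sub>k\<close>. In terms of \<open>x = y + 1/(q y)\<close>, the factor with index \<open>j\<close> is linear in \<open>x\<close>,
  so \<open>S\<^sub>0, \<dots>, S\<^sub>n\<close> are a basis of the polynomials in \<open>x\<close> of degree at most \<open>n\<close>.
\<close>

definition sym_prod :: "nat \<Rightarrow> 'a \<Rightarrow> 'a" where
  "sym_prod k y = (\<Prod>j<k. (1 - y * q ^ Suc j) * (1 - y / q ^ j) / y)"

lemma sym_prod_0 [simp]: "sym_prod 0 y = 1" by (simp add: sym_prod_def)

lemma sym_prod_Suc: "sym_prod (Suc k) y =
    sym_prod k y * ((1 - y * q ^ Suc k) * (1 - y / q ^ k) / y)"
  by (simp add: sym_prod_def)

text \<open>
  For \<open>k > 0\<close> the products \<open>S\<^sub>k(y)\<close> and \<open>S\<^sub>k(q y)\<close> share all but one of their factors. The common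
  part \<open>B\<close> is kept abstract: dividing one value by the other is not possible at the zeros of
  \<open>S\<^sub>k\<close>.
\<close>

lemma sym_prod_factor:
  assumes "y \<noteq> 0"
  obtains B where "sym_prod (Suc k) y = (1 - q * y) * (q ^ Suc k - q * y) * B"
    and "sym_prod (Suc k) (q * y) = (1 - q * y) * (1 - q * y * q ^ Suc k) * B"
proof -
  have "\<exists>B. sym_prod (Suc k) y = (1 - q * y) * (q ^ Suc k - q * y) * B \<and>
     sym_prod (Suc k) (q * y) = (1 - q * y) * (1 - q * y * q ^ Suc k) * B"
  proof (induction k)
    case 0
    show ?case by (rule exI[of _ "1 / (q * y)"]) (use assms in \<open>simp add: sym_prod_def field_simps\<close>)
  next
    case (Suc k)
    then obtain B where B: "sym_prod (Suc k) y = (1 - q * y) * (q ^ Suc k - q * y) * B"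
     "sym_prod (Suc k) (q * y) = (1 - q * y) * (1 - q * y * q ^ Suc k) * B" by blast
    show ?case
    proof (intro exI conjI)
      show "sym_prod (Suc (Suc k)) y = (1 - q * y) * (q ^ Suc (Suc k) - q * y) *
         (B * (1 - q * y * q ^ Suc k) * (1 - y / q ^ k) / (q * y))"
        unfolding sym_prod_Suc[of "Suc k"] B using assms
            by (simp add: divide_simps) (simp add: algebra_simps)
      show "sym_prod (Suc (Suc k)) (q * y) = (1 - q * y) * (1 - q * y * q ^ Suc (Suc k)) *
         (B * (1 - q * y * q ^ Suc k) * (1 - y / q ^ k) / (q * y))"
        unfolding sym_prod_Suc[of "Suc k"] B using assms by (simp add: divide_simps)
    qed
  qed
  then show ?thesis using that by blast
qed

lemma sym_prod_shift:
  assumes "y \<noteq> 0"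
  shows "sym_prod k (q * y) * (q ^ k - q * y) = sym_prod k y * (1 - q * y * q ^ k)"
proof (cases k)
  case (Suc j)
  obtain B where "sym_prod (Suc j) y = (1 - q * y) * (q ^ Suc j - q * y) * B"
    "sym_prod (Suc j) (q * y) = (1 - q * y) * (1 - q * y * q ^ Suc j) * B"
    using sym_prod_factor[OF assms] .
  then show ?thesis by (simp add: Suc)
qed simp

text \<open>
  The relation of \<open>delannoy_product_corner\<close>, with \<open>y = q^m\<close> and \<open>z = q^n\<close>. After splitting off
  the common factors, this is an identity between polynomials in \<open>q^k\<close>, \<open>y\<close> and \<open>z\<close>.
\<close>

lemma sym_prod_corner:
  assumes "y \<noteq> 0" "z \<noteq> 0"
  shows "(1 - q * z * (q * y)) *
      (sym_prod k (q * y) * sym_prod k z - sym_prod k y * sym_prod k (q * z)) =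
    (q * y - q * z) * (sym_prod k (q * y) * sym_prod k (q * z) - sym_prod k y * sym_prod k z)"
proof (cases k)
  case (Suc j)
  obtain B where B: "sym_prod (Suc j) y = (1 - q * y) * (q ^ Suc j - q * y) * B"
    "sym_prod (Suc j) (q * y) = (1 - q * y) * (1 - q * y * q ^ Suc j) * B"
    using sym_prod_factor[OF assms(1)] .
  obtain C where C: "sym_prod (Suc j) z = (1 - q * z) * (q ^ Suc j - q * z) * C"
    "sym_prod (Suc j) (q * z) = (1 - q * z) * (1 - q * z * q ^ Suc j) * C"
    using sym_prod_factor[OF assms(2)] .
  show ?thesis unfolding Suc B C by algebra
qed simp

lemma sym_prod_eq_0: "n < k \<Longrightarrow> sym_prod k (q ^ n) = 0"
  unfolding sym_prod_def by (subst prod_zero_iff) (auto intro!: bexI[of _ n])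

text \<open>
  Along the powers of \<open>q\<close> the function is a \<open>q\<close>-binomial coefficient up to known factors. This
  is what makes the final summands Laurent polynomials with integer coefficients.
\<close>

lemma sym_prod_power: "sym_prod k (q ^ m) =
    qpochhammer q q (2 * k) * qbinomial q (m + k) (2 * k) / q ^ (k * m)"
proof (cases "k \<le> m")
  case True
  then have "sym_prod k (q ^ m) = qpochhammer q q (m + k) / qpochhammer q q (m - k) / q ^ (k * m)"
  proof (induction k)
    case (Suc k)
    then have mk: "m - k = Suc (m - Suc k)" by simp
    have *: "q ^ m / q ^ k = q ^ (m - k)" using Suc.prems by (simp add: power_diff)
    have "sym_prod (Suc k) (q ^ m) = qpochhammer q q (m + k) * (1 - q ^ (Suc (m + k))) *
       ((1 - q ^ (m - k)) / qpochhammer q q (m - k)) / (q ^ (k * m) * q ^ m)"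
      using Suc unfolding sym_prod_Suc * by (simp add: power_add mult_ac)
    also have "(1 - q ^ (m - k)) / qpochhammer q q (m - k) = 1 / qpochhammer q q (m - Suc k)"
      unfolding mk qpochhammer_Suc_q using one_minus_q_power_nonzero[of "m - Suc k"] by simp
    finally show ?case by (simp add: qpochhammer_Suc_q power_add)
  qed auto
  then show ?thesis using True by (simp add: qbinomial_def)
next
  case False
  then show ?thesis by (simp add: sym_prod_eq_0)
qed

text \<open>
  The coefficients \<open>c\<^sub>k\<close>. The value is forced: multiplied by \<open>S\<^sub>k(q^k)\<close>, it must be the product of
  the constant terms, as polynomials in \<open>y = q^m\<close>, of \<open>D\<^sub>q(m,k)\<close> and \<open>y^k D\<^bsub>1/q\<^esub>(m,k)\<close>.
\<close>

definition expansion_coeff :: "nat \<Rightarrow> 'a" where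
  "expansion_coeff k = q ^ (k\<^sup>2) * qpochhammer (-1) q k * qpochhammer (- q) q k /
     ((qpochhammer q q k)\<^sup>2 * qpochhammer q q (2 * k))"

text \<open>
  For fixed \<open>n\<close>, the number \<open>D(m,n)\<close> is a polynomial in \<open>q^m\<close>, since \<open>[n+m-k choose n]\<close> is, for
  \<open>k \<le> n \<le> m\<close>, the product of the \<open>n\<close> factors \<open>1 - q^m q^(i+1) / q^k\<close> divided by \<open>(q;q)\<^sub>n\<close>. For
  the base \<open>1/q\<close> the polynomial is evaluated at \<open>1/q^m\<close>; the reversed polynomial makes its value
  polynomial in \<open>q^m\<close> again.
\<close>

definition delannoy_poly :: "nat \<Rightarrow> 'a poly" where
  "delannoy_poly n = (\<Sum>k\<le>n. smult (qprod_coeff n k /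
      qpochhammer q q n) (\<Prod>i<n. [:1, - (q ^ Suc i / q ^ k):]))"

definition reversed_delannoy_poly :: "nat \<Rightarrow> 'a poly" where
  "reversed_delannoy_poly n = (\<Sum>k\<le>n. smult (qprod_coeff n k /
      qpochhammer q q n) (\<Prod>i<n. [:- (q ^ Suc i / q ^ k), 1:]))"

lemma poly_reversed_delannoy_poly:
  assumes "y \<noteq> 0"
  shows "poly (reversed_delannoy_poly n) y = y ^ n * poly (delannoy_poly n) (inverse y)"
proof -
  have "(\<Prod>i<n. y - q ^ Suc i / q ^ k) = y ^ n * (\<Prod>i<n. 1 - inverse y * (q ^ Suc i / q ^ k))" for k
  proof -
    have "(\<Prod>i<n. y - q ^ Suc i / q ^ k) = (\<Prod>i<n. y * (1 - inverse y * (q ^ Suc i / q ^ k)))"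
      using assms by (intro prod.cong) (simp_all add: field_simps)
    then show ?thesis by (simp add: prod.distrib)
  qed
  then show ?thesis
    by (simp add: delannoy_poly_def reversed_delannoy_poly_def poly_sum poly_prod sum_distrib_left
        mult_ac)
qed

lemma qpochhammer_add: "qpochhammer q q (j + n) = qpochhammer q q j * (\<Prod>i<n. 1 - q ^ j * q ^ Suc i)"
  by (induction n) (simp_all add: qpochhammer_Suc_q power_add mult_ac)

lemma poly_delannoy_poly:
  assumes "n \<le> m"
  shows "poly (delannoy_poly n) (q ^ m) = qdelannoy q m n"
proof -
  have "(\<Prod>i<n. 1 - q ^ m * (q ^ Suc i / q ^ k)) / qpochhammer q q n = qbinomial q (n + m - k) n"
    if "k \<le> n" for k
  proof -
    have "q ^ m / q ^ k = q ^ (m - k)" using that assms by (simp add: power_diff)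
    then have "(\<Prod>i<n. 1 - q ^ m * (q ^ Suc i / q ^ k)) = (\<Prod>i<n. 1 - q ^ (m - k) * q ^ Suc i)"
      by (intro prod.cong) (auto simp: field_simps)
    moreover have "qbinomial q (n + m - k) n =
        qpochhammer q q ((m - k) + n) / (qpochhammer q q n * qpochhammer q q (m - k))"
      using that assms by (simp add: qbinomial_def add.commute)
    ultimately show ?thesis by (simp add: qpochhammer_add)
  qed
  then show ?thesis
    unfolding delannoy_poly_def qdelannoy_def atMost_atLeast0 poly_sum
    by (intro sum.cong) (auto simp: poly_prod qprod_coeff_def simp flip: times_divide_eq_right)
qed

lemma poly_delannoy_poly_0: "poly (delannoy_poly n) 0 = qpochhammer (-1) q n / qpochhammer q q n"
  using q_binomial_theorem[of n 1]
  by (simp add: delannoy_poly_def poly_sum poly_prod qpochhammer_def flip: sum_divide_distrib)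

lemma poly_reversed_delannoy_poly_0:
  "poly (reversed_delannoy_poly n) 0 =
     qpochhammer (- inverse q) (inverse q) n / qpochhammer (inverse q) (inverse q) n"
proof -
  have nz: "(\<Prod>i<n. 1 - inverse q ^ Suc i) \<noteq> 0"
    using one_minus_q_power_nonzero by (auto simp: field_simps)
  have "(\<Prod>i<n. - (q ^ Suc i / q ^ k)) = (\<Prod>i<n. - (q ^ Suc i)) * inverse (q ^ n) ^ k" for k
  proof -
    have "(\<Prod>i<n. - (q ^ Suc i / q ^ k)) = (\<Prod>i<n. - (q ^ Suc i) * inverse (q ^ k))"
      by (simp add: divide_inverse)
    also have "\<dots> = (\<Prod>i<n. - (q ^ Suc i)) * inverse (q ^ k) ^ n"
      unfolding prod.distrib by simp
    also have "inverse (q ^ k) ^ n = inverse (q ^ n) ^ k"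
      by (simp add: power_inverse mult.commute flip: power_mult)
    finally show ?thesis .
  qed
  then have "poly (reversed_delannoy_poly n) 0 =
      (\<Sum>k\<le>n. qprod_coeff n k * inverse (q ^ n) ^ k) * (\<Prod>i<n. - (q ^ Suc i)) / qpochhammer q q n"
    unfolding sum_distrib_right sum_divide_distrib reversed_delannoy_poly_def poly_sum
    by (intro sum.cong) (simp_all add: poly_prod mult_ac)
  also have "(\<Sum>k\<le>n. qprod_coeff n k * inverse (q ^ n) ^ k) = (\<Prod>i<n. 1 + inverse (q ^ n) * q ^ i)"
    by (rule q_binomial_theorem)
  also have "\<dots> = (\<Prod>i<n. 1 + inverse q ^ Suc (n - Suc i))"
    by (intro prod.cong) (auto simp: field_simps power_inverse simp flip: power_add power_Suc)
  also have "\<dots> = (\<Prod>i<n. 1 + inverse q ^ Suc i)"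
    by (rule prod.nat_diff_reindex)
  also have "qpochhammer q q n = (\<Prod>i<n. - (q ^ Suc i)) * (\<Prod>i<n. 1 - inverse q ^ Suc i)"
    unfolding qpochhammer_def prod.distrib[symmetric]
    by (intro prod.cong) (simp_all add: field_simps)
  finally show ?thesis using nz by (simp add: qpochhammer_def)
qed

definition cleared_sym_prod :: "nat \<Rightarrow> 'a poly" where
  "cleared_sym_prod n = (\<Prod>j<n. [:1, - (q ^ Suc j):] * [:1, - inverse (q ^ j):])"

lemma poly_cleared_sym_prod: "y \<noteq> 0 \<Longrightarrow> poly (cleared_sym_prod n) y = y ^ n * sym_prod n y"
proof (induction n)
  case (Suc n)
  have "poly (cleared_sym_prod (Suc n)) y =
      poly (cleared_sym_prod n) y * ((1 - y * q ^ Suc n) * (1 - y / q ^ n))"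
    by (simp only: cleared_sym_prod_def prod.lessThan_Suc poly_mult) (simp add: divide_inverse)
  then show ?case using Suc by (simp add: sym_prod_Suc)
qed (simp add: cleared_sym_prod_def)

lemma poly_cleared_sym_prod_0: "poly (cleared_sym_prod n) 0 = 1"
  by (simp add: cleared_sym_prod_def poly_prod)

lemma expansion_coeff_diagonal:
  "expansion_coeff n * sym_prod n (q ^ n) =
   qpochhammer (-1) q n * qpochhammer (- q) q n / (qpochhammer q q n)\<^sup>2"
  by (simp add: sym_prod_power expansion_coeff_def power2_eq_square flip: mult_2)

lemma sym_prod_diagonal_nonzero: "sym_prod n (q ^ n) \<noteq> 0"
  by (simp add: sym_prod_power flip: mult_2)

text \<open>
  If the two sides of the expansion differ by \<open>C S\<^sub>n(q^m)\<close> for all \<open>m\<close>, then multiplication by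
  \<open>q^(m n)\<close> gives a polynomial identity in \<open>y = q^m\<close> which holds at infinitely many points. At
  \<open>y = 0\<close> every summand with \<open>k < n\<close> vanishes because of the factor \<open>y^(n-k)\<close>, and the
  coefficient \<open>c\<^sub>n\<close> is the one for which the remaining values cancel.
\<close>

lemma sym_prod_multiple_eq_0:
  assumes "\<And>m. delannoy_product m n -
      (\<Sum>k\<le>n. expansion_coeff k * sym_prod k (q ^ m) * sym_prod k (q ^ n)) = C * sym_prod n (q ^ m)"
  shows "C = 0"
proof -
  define W where "W = delannoy_poly n * generic_base.reversed_delannoy_poly (inverse q) n
     - (\<Sum>k\<le>n. smult (expansion_coeff k * sym_prod k (q ^ n)) (monom 1 (n - k) *
         cleared_sym_prod k)) - smult C (cleared_sym_prod n)"
  have root: "poly W (q ^ m) = 0" if "n \<le> m" for m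
  proof -
    have "poly (generic_base.reversed_delannoy_poly (inverse q) n) (q ^ m) =
       (q ^ m) ^ n * poly (generic_base.delannoy_poly (inverse q) n) (inverse q ^ m)"
      using generic_base.poly_reversed_delannoy_poly[OF generic_base_inverse, of "q ^ m" n]
          by (simp add: power_inverse)
    also have "\<dots> = (q ^ m) ^ n * qdelannoy (inverse q) m n"
      using generic_base.poly_delannoy_poly[OF generic_base_inverse that] by simp
    finally have "poly (delannoy_poly n *
        generic_base.reversed_delannoy_poly (inverse q) n) (q ^ m) =
        (q ^ m) ^ n * delannoy_product m n"
      using poly_delannoy_poly[OF that] by (simp add: delannoy_product_def)
    moreover have "(q ^ m) ^ (n - k) * (q ^ m) ^ k = (q ^ m) ^ n" if "k \<le> n" for k
      using that by (simp flip: power_add)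
    then have "poly (\<Sum>k\<le>n. smult (expansion_coeff k * sym_prod k (q ^ n)) (monom 1 (n - k) *
        cleared_sym_prod k)) (q ^ m) =
      (q ^ m) ^ n * (\<Sum>k\<le>n. expansion_coeff k * sym_prod k (q ^ m) * sym_prod k (q ^ n))"
      unfolding poly_sum sum_distrib_left
      by (intro sum.cong) (auto simp: poly_monom poly_cleared_sym_prod)
    ultimately have "poly W (q ^ m) = (q ^ m) ^ n *
        (delannoy_product m n -
            (\<Sum>k\<le>n. expansion_coeff k * sym_prod k (q ^ m) * sym_prod k (q ^ n)) - C *
            sym_prod n (q ^ m))"
      by (simp add: W_def poly_cleared_sym_prod algebra_simps)
    then show ?thesis using assms by simp
  qed
  have "infinite ((\<lambda>m. q ^ m) ` {n..})"
    by (subst finite_image_iff) (auto intro!: inj_onI simp: infinite_Ici)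
  moreover have "(\<lambda>m. q ^ m) ` {n..} \<subseteq> {x. poly W x = 0}" using root by auto
  ultimately have "infinite {x. poly W x = 0}" using infinite_super by blast
  then have "W = 0" using poly_roots_finite by blast
  moreover have "poly (\<Sum>k\<le>n. smult (expansion_coeff k * sym_prod k (q ^ n)) (monom 1 (n - k) *
      cleared_sym_prod k)) 0
     = (\<Sum>k\<le>n. if k = n then expansion_coeff n * sym_prod n (q ^ n) else 0)"
    unfolding poly_sum by (intro sum.cong) (auto simp: poly_monom poly_cleared_sym_prod_0)
  then have "poly (\<Sum>k\<le>n. smult (expansion_coeff k * sym_prod k (q ^ n)) (monom 1 (n - k) *
      cleared_sym_prod k)) 0 =
      poly (delannoy_poly n * generic_base.reversed_delannoy_poly (inverse q) n) 0"
    using generic_base.poly_reversed_delannoy_poly_0[OF generic_base_inverse, of n]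
    by (simp add: expansion_coeff_diagonal poly_delannoy_poly_0 power2_eq_square)
  ultimately have "0 = - C * poly (cleared_sym_prod n) 0"
    unfolding W_def by (metis (no_types, lifting) cancel_comm_monoid_add_class.diff_cancel diff_0
        mult_minus_left poly_0 poly_diff poly_smult)
  then show ?thesis by (simp add: poly_cleared_sym_prod_0)
qed

text \<open>
  Once the difference \<open>v\<close> of the two sides vanishes on row \<open>n\<close>, the corner relation becomes a
  first-order recurrence in \<open>m\<close> for row \<open>n + 1\<close>, which \<open>S\<^bsub>n+1\<^esub>(q^m)\<close> solves too. The leading
  coefficient of the recurrence vanishes only at the step from \<open>m = n\<close> to \<open>m = n + 1\<close>, so that
  the value of \<open>v\<close> at \<open>(n+1, n+1)\<close> is the single free constant.
\<close>

theorem delannoy_product_expansion: "delannoy_product m n =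
    (\<Sum>k\<le>n. expansion_coeff k * sym_prod k (q ^ m) * sym_prod k (q ^ n))"
proof -
  define S where "S m n = (\<Sum>k\<le>n. expansion_coeff k * sym_prod k (q ^ m) *
      sym_prod k (q ^ n))" for m n
  define v where "v m n = delannoy_product m n - S m n" for m n
  have S_corner: "(1 - q ^ Suc n * q ^ Suc m) * (S (Suc m) n - S m (Suc n)) =
     (q ^ Suc m - q ^ Suc n) * (S (Suc m) (Suc n) - S m n)" for m n
  proof -
    \<comment> \<open>The term with index \<open>n + 1\<close> vanishes on row \<open>n\<close>, so both rows can use the same range of \<open>k\<close>.\<close>
    have S_Suc: "S m n = (\<Sum>k\<le>Suc n. expansion_coeff k * sym_prod k (q ^ m) *
        sym_prod k (q ^ n))" for m
      by (simp add: S_def sym_prod_eq_0)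
    have "(1 - q ^ Suc n * q ^ Suc m) *
        (expansion_coeff k * sym_prod k (q ^ Suc m) * sym_prod k (q ^ n)
         - expansion_coeff k * sym_prod k (q ^ m) * sym_prod k (q ^ Suc n)) =
      (q ^ Suc m - q ^ Suc n) * (expansion_coeff k * sym_prod k (q ^ Suc m) * sym_prod k (q ^ Suc n)
         - expansion_coeff k * sym_prod k (q ^ m) * sym_prod k (q ^ n))" for k
      using arg_cong[OF sym_prod_corner[of "q ^ m" "q ^ n" k], of "\<lambda>x. expansion_coeff k * x"]
      by (simp add: algebra_simps)
    then show ?thesis
      unfolding S_Suc unfolding S_def sum_subtractf[symmetric] sum_distrib_left by simp
  qed
  have v_corner: "(1 - q ^ Suc n * q ^ Suc m) * (v (Suc m) n - v m (Suc n)) =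
     (q ^ Suc m - q ^ Suc n) * (v (Suc m) (Suc n) - v m n)" for m n
  proof -
    have "(1 - q ^ Suc n * q ^ Suc m) * (v (Suc m) n - v m (Suc n)) =
      (1 - q ^ Suc n * q ^ Suc m) * (delannoy_product (Suc m) n - delannoy_product m (Suc n))
       - (1 - q ^ Suc n * q ^ Suc m) * (S (Suc m) n - S m (Suc n))"
      by (simp add: v_def algebra_simps)
    also have "\<dots> = (q ^ Suc m - q ^ Suc n) * (v (Suc m) (Suc n) - v m n)"
      unfolding S_corner delannoy_product_corner by (simp add: v_def algebra_simps)
    finally show ?thesis .
  qed
  have v0: "v 0 n = 0" for n
  proof -
    have "expansion_coeff k * sym_prod k (q ^ 0) * sym_prod k (q ^ n) =
        (if k = 0 then 1 else 0)" for k
      using sym_prod_eq_0[of 0 k] by (auto simp: expansion_coeff_def)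
    then have "S 0 n = 1" by (simp add: S_def)
    then show ?thesis
      using generic_base.qdelannoy_0_left[OF generic_base_inverse]
          by (simp add: v_def delannoy_product_def)
  qed
  have "v m n = 0" for m
  proof (induction n arbitrary: m)
    case 0
    show ?case using generic_base.qdelannoy_0_right[OF generic_base_inverse]
      by (simp add: v_def S_def expansion_coeff_def delannoy_product_def)
  next
    case (Suc n)
    define C where "C = v (Suc n) (Suc n) / sym_prod (Suc n) (q ^ Suc n)"
    have multiple: "v m (Suc n) = C * sym_prod (Suc n) (q ^ m)" for m
    proof (induction m)
      case 0
      show ?case using sym_prod_eq_0[of 0 "Suc n"] by (simp add: v0)
    next
      case (Suc m)
      show ?case
      proof (cases "m = n")
        case True
        then show ?thesis using sym_prod_diagonal_nonzero[of "Suc n"] by (simp add: C_def)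
      next
        case False
        then have nz: "q ^ Suc n - q * q ^ m \<noteq> 0" by (simp flip: power_Suc)
        have "v (Suc m) (Suc n) * (q ^ Suc n - q * q ^ m) =
              v m (Suc n) * (1 - q * q ^ m * q ^ Suc n)"
          using v_corner[of n m] by (simp add: Suc.IH \<open>\<And>m. v m n = 0\<close> algebra_simps)
        also have "\<dots> = C * (sym_prod (Suc n) (q ^ Suc m) * (q ^ Suc n - q * q ^ m))"
          using sym_prod_shift[of "q ^ m" "Suc n"] by (simp add: Suc.IH)
        finally show ?thesis using nz by simp
      qed
    qed
    then have "C = 0" by (intro sym_prod_multiple_eq_0[of "Suc n"]) (simp only: v_def S_def)
    then show ?case by (simp add: multiple)
  qed
  then show ?thesis by (simp add: v_def S_def)
qed

section \<open>Summation over the second argument\<close>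

text \<open>
  An antidifference, up to the factor \<open>q^(k+1) / (1 - q^(k+1))\<close>, of the weight times \<open>S\<^sub>k\<close>. The
  factor \<open>1 - y\<close> makes it vanish at the lower end \<open>y = q^0\<close> of the range of summation.
\<close>

definition antidiff :: "nat \<Rightarrow> 'a \<Rightarrow> 'a" where
  "antidiff k y = sym_prod k y * (1 - y) * (1 - y / q ^ k) / y"

lemma antidiff_diff:
  assumes "y \<noteq> 0"
  shows "(1 / y - q * y) * sym_prod k y * (1 - q ^ Suc k) =
      q ^ Suc k * (antidiff k (q * y) - antidiff k y)"
proof -
  have "q ^ Suc k * antidiff k (q * y) = (sym_prod k (q * y) * (q ^ k - q * y)) * (1 - q * y) / y"
    using assms by (simp add: antidiff_def field_simps)
  also have "\<dots> = sym_prod k y * (1 - q * y * q ^ k) * (1 - q * y) / y"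
    unfolding sym_prod_shift[OF assms] ..
  finally show ?thesis
    using assms by (simp add: right_diff_distrib[of _ "antidiff k (q * y)"])
      (simp add: antidiff_def field_simps)
qed

lemma sum_sym_prod:
  "(\<Sum>n<N. (1 / q ^ n - q ^ Suc n) * sym_prod k (q ^ n)) =
      q ^ Suc k / (1 - q ^ Suc k) * antidiff k (q ^ N)"
proof (induction N)
  case 0
  show ?case by (simp add: antidiff_def)
next
  case (Suc N)
  have "(1 / q ^ N - q ^ Suc N) * sym_prod k (q ^ N) =
      q ^ Suc k / (1 - q ^ Suc k) * (antidiff k (q ^ Suc N) - antidiff k (q ^ N))"
    using antidiff_diff[of "q ^ N" k] one_minus_q_power_nonzero[of k] by (simp add: field_simps)
  then show ?case unfolding sum.lessThan_Suc Suc by (simp add: algebra_simps)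
qed

lemma qint_eq: "qint q n = (1 - q ^ n) / (1 - q)"
  by (simp add: qint_def sum_gp_strict)

lemma antidiff_power:
  assumes "k < N"
  shows "antidiff k (q ^ N) =
    (1 - q ^ N) * qpochhammer q q (N + k) / (qpochhammer q q (N - Suc k) * q ^ (Suc k * N))"
proof -
  have "q ^ N / q ^ k = q ^ Suc (N - Suc k)"
    using assms by (simp add: Suc_diff_Suc power_diff del: power_Suc)
  moreover have "sym_prod k (q ^ N) = qpochhammer q q (N + k) /
      (qpochhammer q q (N - Suc k) * (1 - q ^ Suc (N - Suc k))) / q ^ (k * N)"
    unfolding qpochhammer_Suc_q[symmetric]
    using assms by (simp add: sym_prod_power qbinomial_def Suc_diff_Suc)
  ultimately show ?thesis
    using one_minus_q_power_nonzero[of "N - Suc k"] unfolding antidiff_def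
    by (simp only: power_add mult_Suc) (simp add: mult_ac)
qed

text \<open>
  Expanding the product and summing over \<open>n\<close> first. The factors \<open>[N+k choose k]\<close>,
  \<open>[N choose k+1]\<close> and \<open>[N]\<close> come from regrouping the value of the antidifference at \<open>q^N\<close> and
  the denominators of \<open>c\<^sub>k\<close>. In particular the denominator \<open>1 - q^(k+1)\<close> is absorbed into
  \<open>[N choose k+1]\<close>.
\<close>

lemma weighted_delannoy_sum:
  "(\<Sum>n<N. (1 - q ^ (2 * n + 1)) / (1 - q) * delannoy_product m n / q ^ n) =
   (\<Sum>k<N. q ^ (k\<^sup>2 + Suc k) / q ^ (k * m + Suc k * N) * qpochhammer (-1) q k *
       qpochhammer (- q) q k *
     qbinomial q (m + k) (2 * k) * qbinomial q (N + k) k * qbinomial q N (Suc k) * qint q N)"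
proof -
  have "(\<Sum>n<N. (1 - q ^ (2 * n + 1)) / (1 - q) * delannoy_product m n / q ^ n) =
    (\<Sum>n<N. \<Sum>k<N. expansion_coeff k * sym_prod k (q ^ m) / (1 - q) *
        ((1 / q ^ n - q ^ Suc n) * sym_prod k (q ^ n)))"
  proof (intro sum.cong)
    fix n assume "n \<in> {..<N}"
    then have E: "delannoy_product m n =
        (\<Sum>k<N. expansion_coeff k * sym_prod k (q ^ m) * sym_prod k (q ^ n))"
      unfolding delannoy_product_expansion
          by (intro sum.mono_neutral_left) (auto simp: sym_prod_eq_0)
    have weight: "(1 - q ^ (2 * n + 1)) / (1 - q) * x / q ^ n =
        1 / (1 - q) * (1 / q ^ n - q ^ Suc n) * x" for x
      by (simp add: divide_simps power_add mult_2)
    show "(1 - q ^ (2 * n + 1)) / (1 - q) * delannoy_product m n / q ^ n =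
      (\<Sum>k<N. expansion_coeff k * sym_prod k (q ^ m) / (1 - q) *
          ((1 / q ^ n - q ^ Suc n) * sym_prod k (q ^ n)))"
      unfolding weight unfolding E sum_distrib_left by (simp add: mult_ac)
  qed simp
  also have "\<dots> = (\<Sum>k<N. expansion_coeff k * sym_prod k (q ^ m) / (1 - q) *
      (q ^ Suc k / (1 - q ^ Suc k) * antidiff k (q ^ N)))"
    by (subst sum.swap) (simp only: sum_distrib_left[symmetric] sum_sym_prod)
  also have "\<dots> = (\<Sum>k<N. q ^ (k\<^sup>2 + Suc k) / q ^ (k * m + Suc k * N) * qpochhammer (-1) q k *
      qpochhammer (- q) q k *
     qbinomial q (m + k) (2 * k) * qbinomial q (N + k) k * qbinomial q N (Suc k) * qint q N)"
  proof (intro sum.cong)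
    fix k assume "k \<in> {..<N}"
    then have k: "k < N" by simp
    have "qbinomial q (N + k) k = qpochhammer q q (N + k) / (qpochhammer q q k * qpochhammer q q N)"
      by (simp add: qbinomial_def)
    moreover have "qbinomial q N (Suc k) = qpochhammer q q N /
       (qpochhammer q q k * (1 - q ^ Suc k) * qpochhammer q q (N - Suc k))"
      using k by (simp add: qbinomial_def qpochhammer_Suc_q)
    ultimately show "expansion_coeff k * sym_prod k (q ^ m) / (1 - q) *
        (q ^ Suc k / (1 - q ^ Suc k) * antidiff k (q ^ N)) =
      q ^ (k\<^sup>2 + Suc k) / q ^ (k * m + Suc k * N) * qpochhammer (-1) q k * qpochhammer (- q) q k *
     qbinomial q (m + k) (2 * k) * qbinomial q (N + k) k * qbinomial q N (Suc k) * qint q N"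
      unfolding antidiff_power[OF k] sym_prod_power expansion_coeff_def qint_eq
      by (simp add: power_add power2_eq_square mult_ac)
  qed simp
  finally show ?thesis .
qed

end

section \<open>Congruences between Laurent polynomials\<close>

lemma qvar_power: "qvar ^ n = to_fract (monom 1 n)"
proof (induction n)
  case (Suc n)
  then show ?case by (simp add: qvar_def monom_Suc flip: to_fract_mult)
qed (simp add: monom_eq_1)

lemma qvar_nonzero [simp]: "qvar \<noteq> 0"
  by (simp add: qvar_def)

interpretation Q: generic_base qvar
proof
  fix i :: nat assume "0 < i"
  then have "monom 1 i \<noteq> (1 :: int poly)"
      by (metis degree_1 degree_monom_eq less_numeral_extra(3) one_neq_zero)
  then show "qvar ^ i \<noteq> 1" unfolding qvar_power by (metis to_fract_1 to_fract_eq_iff)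
qed simp

lemma laurent_polysI: "to_fract f / qvar ^ n \<in> laurent_polys"
  by (auto simp: laurent_polys_def)

lemma laurent_polysE:
  assumes "A \<in> laurent_polys"
  obtains f n where "A = to_fract f / qvar ^ n"
  using assms by (auto simp: laurent_polys_def)

lemma laurent_add [intro]:
  assumes "A \<in> laurent_polys" "B \<in> laurent_polys"
  shows "A + B \<in> laurent_polys"
proof -
  obtain f n g m where A: "A = to_fract f / qvar ^ n" and B: "B = to_fract g / qvar ^ m"
    using assms by (metis laurent_polysE)
  have "A + B = (to_fract f * qvar ^ m + to_fract g * qvar ^ n) / qvar ^ (n + m)"
    unfolding A B by (simp add: field_simps power_add)
  also have "\<dots> = to_fract (f * monom 1 m + g * monom 1 n) / qvar ^ (n + m)"
    by (simp add: qvar_power)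
  finally show ?thesis using laurent_polysI by metis
qed

lemma laurent_mult [intro]:
  assumes "A \<in> laurent_polys" "B \<in> laurent_polys"
  shows "A * B \<in> laurent_polys"
proof -
  obtain f n g m where A: "A = to_fract f / qvar ^ n" and B: "B = to_fract g / qvar ^ m"
    using assms by (metis laurent_polysE)
  have "A * B = to_fract (f * g) / qvar ^ (n + m)"
    unfolding A B by (simp add: field_simps power_add)
  then show ?thesis using laurent_polysI by metis
qed

lemma laurent_to_fract [intro]: "to_fract f \<in> laurent_polys"
  using laurent_polysI[of f 0] by simp

lemma laurent_0 [intro, simp]: "0 \<in> laurent_polys" using laurent_to_fract[of 0] by simp
lemma laurent_1 [intro, simp]: "1 \<in> laurent_polys" using laurent_to_fract[of 1] by simp
lemma laurent_qvar [intro, simp]: "qvar \<in> laurent_polys" by (auto simp: qvar_def)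
lemma laurent_inverse_qvar [intro, simp]: "inverse qvar \<in> laurent_polys"
  using laurent_polysI[of 1 1] by (simp add: field_simps)

lemma laurent_uminus [intro]: "A \<in> laurent_polys \<Longrightarrow> - A \<in> laurent_polys"
  using laurent_mult[OF laurent_to_fract[of "-1"], of A] by simp

lemma laurent_diff [intro]: "A \<in> laurent_polys \<Longrightarrow> B \<in> laurent_polys \<Longrightarrow> A - B \<in> laurent_polys"
  using laurent_add[of A "- B"] by auto

lemma laurent_power [intro]: "A \<in> laurent_polys \<Longrightarrow> A ^ n \<in> laurent_polys"
  by (induction n) auto

lemma laurent_powi [intro]: "qvar powi z \<in> laurent_polys"
  by (auto simp: power_int_def)

lemma laurent_of_nat [intro]: "of_nat n \<in> laurent_polys"
  by (induction n) auto

lemma laurent_sum [intro]: "(\<And>i. i \<in> I \<Longrightarrow> f i \<in> laurent_polys) \<Longrightarrow> sum f I \<in> laurent_polys"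
  by (induction I rule: infinite_finite_induct) auto

lemma laurent_prod [intro]: "(\<And>i. i \<in> I \<Longrightarrow> f i \<in> laurent_polys) \<Longrightarrow> prod f I \<in> laurent_polys"
  by (induction I rule: infinite_finite_induct) auto

lemma laurent_qint [intro]: "x \<in> laurent_polys \<Longrightarrow> qint x n \<in> laurent_polys"
  by (auto simp: qint_def)

lemma laurent_qpochhammer [intro]:
  "a \<in> laurent_polys \<Longrightarrow> x \<in> laurent_polys \<Longrightarrow> qpochhammer a x n \<in> laurent_polys"
  by (auto simp: qpochhammer_def)

lemma laurent_qbinomial [intro]: "qbinomial qvar n k \<in> laurent_polys"
proof (induction n arbitrary: k)
  case (Suc n)
  then show ?case by (cases k) (auto simp: Q.qbinomial_Suc_Suc simp del: power_Suc)
qed (case_tac k; auto)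

text \<open>
  The congruence with the modulus in front: the calculational style needs the two related
  elements as the last two arguments.
\<close>

definition lcong :: "int poly fract \<Rightarrow> int poly fract \<Rightarrow> int poly fract \<Rightarrow> bool" where
  "lcong M A B \<longleftrightarrow> laurent_cong A B M"

lemma lcong_iff: "lcong M A B \<longleftrightarrow>
    A \<in> laurent_polys \<and> B \<in> laurent_polys \<and> (\<exists>L\<in>laurent_polys. A - B = M * L)"
  by (simp add: lcong_def laurent_cong_def)

lemma lcong_refl [intro]: "A \<in> laurent_polys \<Longrightarrow> lcong M A A"
  by (auto simp: lcong_iff intro!: bexI[of _ 0])

lemma lcong_sym: "lcong M A B \<Longrightarrow> lcong M B A"
  unfolding lcong_iff by (metis laurent_uminus minus_diff_eq mult_minus_right)

lemma lcong_trans [trans]: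
  assumes "lcong M A B" "lcong M B C"
  shows "lcong M A C"
proof -
  obtain L L' where "L \<in> laurent_polys" "A - B = M * L" "L' \<in> laurent_polys" "B - C = M * L'"
    using assms by (auto simp: lcong_iff)
  then have "A - C = M * (L + L')" "L + L' \<in> laurent_polys" by (auto simp: algebra_simps)
  then show ?thesis using assms by (auto simp: lcong_iff)
qed

lemma lcong_add:
  assumes "lcong M A B" "lcong M C D"
  shows "lcong M (A + C) (B + D)"
proof -
  obtain L L' where "L \<in> laurent_polys" "A - B = M * L" "L' \<in> laurent_polys" "C - D = M * L'"
    using assms by (auto simp: lcong_iff)
  then have "(A + C) - (B + D) = M * (L + L')" "L + L' \<in> laurent_polys"
      by (auto simp: algebra_simps)
  then show ?thesis using assms by (auto simp: lcong_iff)
qed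

lemma lcong_mult:
  assumes "lcong M A B" "lcong M C D"
  shows "lcong M (A * C) (B * D)"
proof -
  obtain L L' where L: "L \<in> laurent_polys" "A - B = M * L" "L' \<in> laurent_polys" "C - D = M * L'"
    using assms by (auto simp: lcong_iff)
  have "A * C - B * D = (A - B) * C + B * (C - D)" by (simp add: algebra_simps)
  also have "\<dots> = M * (L * C + B * L')" unfolding L by (simp add: algebra_simps)
  finally have "A * C - B * D = M * (L * C + B * L')" .
  moreover have "L * C + B * L' \<in> laurent_polys" using assms L by (auto simp: lcong_iff)
  ultimately show ?thesis using assms by (auto simp: lcong_iff)
qed

lemma lcong_mult_left: "A \<in> laurent_polys \<Longrightarrow> lcong M B C \<Longrightarrow> lcong M (A * B) (A * C)"
  by (intro lcong_mult lcong_refl)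

lemma lcong_mult_right: "A \<in> laurent_polys \<Longrightarrow> lcong M B C \<Longrightarrow> lcong M (B * A) (C * A)"
  by (intro lcong_mult lcong_refl)

lemma lcong_power: "lcong M A B \<Longrightarrow> lcong M (A ^ n) (B ^ n)"
  by (induction n) (auto intro: lcong_mult)

lemma lcong_sum:
  "(\<And>i. i \<in> I \<Longrightarrow> lcong M (f i) (g i)) \<Longrightarrow> lcong M (sum f I) (sum g I)"
  by (induction I rule: infinite_finite_induct) (auto intro: lcong_add)

lemma lcong_0: "L \<in> laurent_polys \<Longrightarrow> M \<in> laurent_polys \<Longrightarrow> lcong M (M * L) 0"
  by (auto simp: lcong_iff)

text \<open>
  Reduces a congruence modulo \<open>[p]^2\<close> between multiples of \<open>[p]\<close> to one modulo \<open>[p]\<close>.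
\<close>

lemma lcong_square_modulus:
  assumes "lcong M A B" "M \<in> laurent_polys"
  shows "lcong (M ^ 2) (M * A) (M * B)"
proof -
  obtain L where "L \<in> laurent_polys" "A - B = M * L" using assms by (auto simp: lcong_iff)
  then have "M * A - M * B = M ^ 2 * L" by (simp add: power2_eq_square flip: right_diff_distrib)
  then show ?thesis using assms \<open>L \<in> _\<close> by (auto simp: lcong_iff)
qed

lemma qint_add: "qint qvar (a + b) = qint qvar a + qvar ^ a * qint qvar b"
  by (simp add: Q.qint_eq field_simps power_add)

lemma qint_mult: "qint qvar (a * b) = qint qvar a * qint (qvar ^ a) b"
proof (cases "a = 0")
  case False
  then show ?thesis using Q.q_power_neq_1[of a]
    by (simp add: qint_def sum_gp_strict power_mult)
qed (simp add: qint_def)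

lemma qbinomial_absorb:
  "qint qvar (Suc k) * qbinomial qvar (Suc n) (Suc k) = qint qvar (Suc n) * qbinomial qvar n k"
proof (cases "k \<le> n")
  case True
  then show ?thesis using Q.one_minus_q_power_nonzero[of k]
    by (simp add: qbinomial_def Q.qint_eq Q.qpochhammer_Suc_q)
qed auto

section \<open>Arithmetic modulo [p]\<close>

context
  fixes p :: nat
  assumes p: "prime p" and odd: "odd p"
begin

abbreviation pcong (infix "\<approx>" 50) where "A \<approx> B \<equiv> lcong (qint qvar p) A B"

lemma p_gt_2: "p > 2"
  using prime_ge_2_nat[OF p] odd by (cases "p = 2") auto

lemma pcong_qvar_p: "qvar ^ p \<approx> 1"
proof -
  have "qvar ^ p - 1 = qint qvar p * (qvar - 1)"
    by (simp add: Q.qint_eq field_simps)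
  then show ?thesis by (auto simp: lcong_iff)
qed

lemma pcong_powi:
  assumes "[z = w] (mod int p)"
  shows "qvar powi z \<approx> qvar powi w"
proof -
  have *: "qvar powi z \<approx> qvar powi w" if "z = w + int p * int t" for z w t
  proof -
    have "qvar powi z = (qvar ^ p) ^ t * qvar powi w"
      unfolding that by (subst power_int_add) (auto simp: power_int_mult)
    also have "\<dots> \<approx> 1 ^ t * qvar powi w"
      by (intro lcong_mult_right lcong_power pcong_qvar_p laurent_powi)
    finally show ?thesis by simp
  qed
  obtain k where k: "z = w + int p * k" using assms by (metis cong_iff_lin cong_sym)
  show ?thesis
  proof (cases "k \<ge> 0")
    case True
    then show ?thesis using *[of z w "nat k"] k by simp
  next
    case False
    then have "w = z + int p * int (nat (- k))" using k by simp
    then show ?thesis by (rule lcong_sym[OF *])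
  qed
qed

text \<open>
  If \<open>j x = 1 + p t\<close>, then \<open>[j]\<close> divides \<open>[j x] = 1 + q [p t]\<close>, and \<open>[p]\<close> divides \<open>[p t]\<close>. So
  the cofactor of \<open>[j]\<close> in \<open>[j x]\<close> is an inverse.
\<close>

lemma pcong_qint_invertible:
  assumes "0 < j" "j < p"
  obtains A where "A \<in> laurent_polys" "qint qvar j * A \<approx> 1"
proof -
  have "coprime j p" using assms p by (metis coprime_commute nat_dvd_not_less prime_imp_coprime_nat)
  then obtain x where "[j * x = 1] (mod p)" using cong_solve_coprime_nat by auto
  then obtain t where t: "j * x = 1 + p * t"
    using p_gt_2 by (metis One_nat_def add.commute cong_def less_trans mod_less mult_div_mod_eq
        one_less_numeral_iff semiring_norm(76))
  have "qint qvar j * qint (qvar ^ j) x = 1 + qvar * (qint qvar p * qint (qvar ^ p) t)"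
    unfolding qint_mult[symmetric] t qint_add by (simp add: qint_def)
  then have "qint qvar j * qint (qvar ^ j) x - 1 = qint qvar p * (qvar * qint (qvar ^ p) t)"
    by simp
  then have "qint qvar j * qint (qvar ^ j) x \<approx> 1"
    unfolding lcong_iff by blast
  then show ?thesis by (rule that[rotated]) blast
qed

lemma pcong_cancel:
  assumes "0 < j" "j < p" "qint qvar j * X \<approx>
      qint qvar j * Y" "X \<in> laurent_polys" "Y \<in> laurent_polys"
  shows "X \<approx> Y"
proof -
  obtain A where A: "A \<in> laurent_polys" "qint qvar j * A \<approx> 1" using pcong_qint_invertible assms
      by blast
  have *: "qint qvar j * A * Z \<approx> Z" if "Z \<in> laurent_polys" for Z
    using lcong_mult_right[OF that A(2)] by simp
  have "A * (qint qvar j * X) \<approx> A * (qint qvar j * Y)" by (rule lcong_mult_left[OF A(1) assms(3)])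
  then have "qint qvar j * A * X \<approx> qint qvar j * A * Y" by (simp add: mult_ac)
  then show ?thesis using *[OF assms(4)] *[OF assms(5)] lcong_sym lcong_trans by blast
qed

lemma pcong_qbinomial_p:
  assumes "0 < j" "j < p"
  shows "qbinomial qvar p j \<approx> 0"
proof (rule pcong_cancel[OF assms])
  have "qint qvar j * qbinomial qvar p j = qint qvar p * qbinomial qvar (p - 1) (j - 1)"
    using qbinomial_absorb[of "j - 1" "p - 1"] assms by simp
  then show "qint qvar j * qbinomial qvar p j \<approx> qint qvar j * 0"
    using lcong_0[of "qbinomial qvar (p - 1) (j - 1)" "qint qvar p"] by auto
qed auto

lemma pcong_qvar_power: "qvar ^ (p * c + d) \<approx> qvar ^ d"
proof -
  have "(qvar ^ p) ^ c * qvar ^ d \<approx> 1 ^ c * qvar ^ d"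
    by (intro lcong_mult_right lcong_power pcong_qvar_p laurent_power laurent_qvar)
  then show ?thesis by (simp add: power_add power_mult)
qed

text \<open>
  The two forms of Pascal's rule used in the induction for the \<open>q\<close>-Lucas theorem: the lower
  index either stays within a block of length \<open>p\<close> or enters a new one.
\<close>

lemma q_lucas_step:
  assumes "\<And>c d. d < p \<Longrightarrow>
      qbinomial qvar (p * a + b) (p * c + d) \<approx> of_nat (a choose c) * qbinomial qvar b d"
  shows "Suc d < p \<Longrightarrow> qbinomial qvar (Suc (p * a + b)) (p * c + Suc d) \<approx>
           of_nat (a choose c) * qbinomial qvar (Suc b) (Suc d)"
    and "qbinomial qvar (Suc (p * a + b)) (p * Suc c) \<approx>
           of_nat (a choose c) * qbinomial qvar b (p - 1) + of_nat (a choose Suc c)"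
proof -
  assume d: "Suc d < p"
  have "qbinomial qvar (p * a + b) (p * c + d) +
      qvar ^ (p * c + Suc d) * qbinomial qvar (p * a + b) (p * c + Suc d) \<approx>
     of_nat (a choose c) * qbinomial qvar b d +
      qvar ^ Suc d * (of_nat (a choose c) * qbinomial qvar b (Suc d))"
    using d by (intro lcong_add lcong_mult pcong_qvar_power assms) auto
  then show "qbinomial qvar (Suc (p * a + b)) (p * c + Suc d) \<approx>
           of_nat (a choose c) * qbinomial qvar (Suc b) (Suc d)"
    by (simp add: Q.qbinomial_Suc_Suc algebra_simps)
next
  have *: "p * Suc c = Suc (p * c + (p - 1))" "p - 1 < p" using p_gt_2 by auto
  have "qbinomial qvar (p * a + b) (p * c + (p - 1)) +
      qvar ^ (p * Suc c + 0) * qbinomial qvar (p * a + b) (p * Suc c + 0) \<approx>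
     of_nat (a choose c) * qbinomial qvar b (p - 1) +
      qvar ^ 0 * (of_nat (a choose Suc c) * qbinomial qvar b 0)"
    using * p_gt_2 by (intro lcong_add lcong_mult pcong_qvar_power assms) auto
  moreover have "qbinomial qvar (Suc (p * a + b)) (p * Suc c) =
     qbinomial qvar (p * a + b) (p * c + (p - 1)) +
      qvar ^ (p * Suc c + 0) * qbinomial qvar (p * a + b) (p * Suc c + 0)"
    unfolding *(1) Q.qbinomial_Suc_Suc by simp
  ultimately show "qbinomial qvar (Suc (p * a + b)) (p * Suc c) \<approx>
           of_nat (a choose c) * qbinomial qvar b (p - 1) + of_nat (a choose Suc c)"
    by simp
qed

text \<open>
  Both sides obey the same Pascal rule modulo \<open>[p]\<close>, as \<open>q^(p c + d)\<close> is congruent to \<open>q^d\<close>.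
  When the upper index enters a new block, the term \<open>[p choose d]\<close> appears, which is \<open>0\<close> modulo
  \<open>[p]\<close> for \<open>0 < d < p\<close>.
\<close>

lemma q_lucas:
  assumes "b < p" "d < p"
  shows "qbinomial qvar (p * a + b) (p * c + d) \<approx> of_nat (a choose c) * qbinomial qvar b d"
  using assms
proof (induction a arbitrary: b c d)
  case 0
  then show ?case by (cases c) (auto intro!: lcong_refl)
next
  case (Suc a)
  show ?case using Suc.prems
  proof (induction b arbitrary: c d)
    case 0
    have IH: "qbinomial qvar (p * a + (p - 1)) (p * c + d) \<approx>
        of_nat (a choose c) * qbinomial qvar (p - 1) d"
      if "d < p" for c d using Suc.IH[of "p - 1" d c] that by simp
    have top: "Suc (p * a + (p - 1)) = p * Suc a + 0" "Suc (p - 1) = p" using p_gt_2 by auto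
    show ?case
    proof (cases d)
      case 0
      then show ?thesis
        using q_lucas_step(2)[OF IH, of "c - 1"] unfolding top
        by (cases c) (auto intro!: lcong_refl)
    next
      case (Suc d')
      have "qbinomial qvar (p * Suc a + 0) (p * c + Suc d') \<approx>
          of_nat (a choose c) * qbinomial qvar p (Suc d')"
        using q_lucas_step(1)[OF IH, of d' c] Suc 0 unfolding top by simp
      also have "\<dots> \<approx> of_nat (a choose c) * 0"
        using Suc 0 by (intro lcong_mult_left pcong_qbinomial_p) auto
      finally show ?thesis by (simp add: Suc)
    qed
  next
    case (Suc b)
    have IH: "qbinomial qvar (p * Suc a + b) (p * c + d) \<approx>
        of_nat (Suc a choose c) * qbinomial qvar b d"
      if "d < p" for c d using Suc.IH[of d c] Suc.prems that by simp
    show ?case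
    proof (cases d)
      case 0
      then show ?thesis
        using q_lucas_step(2)[OF IH, of "c - 1"] Suc.prems
        by (cases c) (auto intro!: lcong_refl)
    next
      case (Suc d')
      then show ?thesis using q_lucas_step(1)[OF IH, of d' c] Suc.prems by simp
    qed
  qed
qed

text \<open>
  By the \<open>q\<close>-binomial theorem the left-hand side is a sum over \<open>k\<close> of multiples of
  \<open>[p choose k]\<close>, of which only the outermost two survive. The last one carries the power
  \<open>q^(p choose 2)\<close>, whose exponent is a multiple of \<open>p\<close> because \<open>p\<close> is odd.
\<close>

lemma pcong_qpochhammer_minus_1: "qpochhammer (-1) qvar p \<approx> 2"
proof -
  have "2 * (p choose 2) = p * (p - 1)" using odd by (simp add: choose_two)
  then have "p dvd p choose 2"
    using odd by (metis coprime_commute coprime_right_2_iff_odd coprime_dvd_mult_right_iff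
        dvd_triv_left)
  then obtain c where c: "p choose 2 = p * c + 0" by auto
  have "qpochhammer (-1) qvar p = (\<Sum>k\<le>p. Q.qprod_coeff p k)"
    using Q.q_binomial_theorem[of p 1] by (simp add: qpochhammer_def)
  also have "\<dots> \<approx> (\<Sum>k\<le>p. if k = 0 \<or> k = p then 1 else 0)"
  proof (intro lcong_sum)
    fix k assume "k \<in> {..p}"
    then consider "k = 0" | "0 < k" "k < p" | "k = p" by force
    then show "Q.qprod_coeff p k \<approx> (if k = 0 \<or> k = p then 1 else 0)"
    proof cases
      case 2
      have "qvar ^ (k choose 2) * qbinomial qvar p k \<approx> qvar ^ (k choose 2) * 0"
        using 2 by (intro lcong_mult_left pcong_qbinomial_p) auto
      then show ?thesis using 2 by (simp add: Q.qprod_coeff_def)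
    next
      case 3
      then show ?thesis using pcong_qvar_power[of c 0] c by (simp add: Q.qprod_coeff_def)
    qed auto
  qed
  also have "(\<Sum>k\<le>p. if k = 0 \<or> k = p then 1 else 0) = (\<Sum>k\<in>{0, p}. 1 :: int poly fract)"
    by (rule sum.mono_neutral_cong_right) auto
  also have "\<dots> = 2" using p_gt_2 by simp
  finally show ?thesis .
qed

text \<open>
  The quotient \<open>(1 + q^p) / (1 + q)\<close> is the \<open>q\<close>-integer \<open>[p]\<close> at \<open>-q\<close>, hence a polynomial.
\<close>

lemma qint_minus_qvar: "(1 + qvar) * qint (- qvar) p = 1 + qvar ^ p"
proof -
  have "qint (- qvar) p * (1 - (- qvar)) = 1 - (- qvar) ^ p"
    unfolding qint_def by (metis mult.commute one_diff_power_eq)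
  then show ?thesis using odd by (simp add: mult.commute)
qed

lemma one_plus_qvar: "1 + qvar = qint qvar 2"
  by (simp add: qint_def numeral_2_eq_2)

text \<open>
  Let \<open>H = (-1;q)\<^bsub>p-1\<^esub>\<close> and \<open>G = (-q;q)\<^bsub>p-1\<^esub>\<close>. Both \<open>H (1 + q^(p-1))\<close> and \<open>2 G\<close> equal \<open>(-1;q)\<^sub>p\<close>,
  which is \<open>2\<close> modulo \<open>[p]\<close>. Since \<open>q (1 + q^(p-1))\<close> is congruent to \<open>1 + q\<close>, this determines
  \<open>(1 + q) H G\<close>, and \<open>1 + q = [2]\<close> can be cancelled.
\<close>

lemma pcong_qpochhammer_product:
  "qpochhammer (-1) qvar (p - 1) * qpochhammer (- qvar) qvar (p - 1) \<approx> qvar * qint (- qvar) p"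
proof (rule pcong_cancel)
  define H G where "H = qpochhammer (-1) qvar (p - 1)" and "G = qpochhammer (- qvar) qvar (p - 1)"
  have L: "H \<in> laurent_polys" "G \<in> laurent_polys"
      by (auto simp: H_def G_def intro!: laurent_qpochhammer)
  have p: "p = Suc (p - 1)" using p_gt_2 by simp
  have "qpochhammer (-1) qvar p = H * (1 + qvar ^ (p - 1))"
    by (subst p) (simp add: H_def qpochhammer_Suc)
  moreover have "qpochhammer (-1) qvar p = 2 * G"
    by (subst p, subst qpochhammer_def, subst prod.lessThan_Suc_shift) (simp add: G_def
        qpochhammer_def)
  ultimately have H: "H * (1 + qvar ^ (p - 1)) = 2 * G" and G: "2 * G \<approx> 2"
    using pcong_qpochhammer_minus_1 by simp_all
  have q: "qvar * (1 + qvar ^ (p - 1)) = qvar + qvar ^ p"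
    by (metis p power_Suc distrib_left mult.right_neutral)
  have "1 + qvar \<approx> qvar ^ p + qvar"
    using pcong_qvar_p by (intro lcong_add) (auto intro: lcong_sym)
  then have "(1 + qvar) * (H * G) \<approx> (qvar ^ p + qvar) * (H * G)"
    using L by (intro lcong_mult_right) auto
  also have "(qvar ^ p + qvar) * (H * G) = qvar * (H * (1 + qvar ^ (p - 1))) * G"
    using q by (simp add: algebra_simps)
  also have "\<dots> = qvar * G * (2 * G)" unfolding H by simp
  also have "\<dots> \<approx> qvar * G * 2" using L G by (intro lcong_mult_left) auto
  also have "\<dots> = qvar * (2 * G)" by simp
  also have "\<dots> \<approx> qvar * (1 + 1)" using G by (intro lcong_mult_left) auto
  also have "\<dots> \<approx> qvar * (1 + qvar ^ p)"
    using pcong_qvar_p by (intro lcong_mult_left lcong_add) (auto intro: lcong_sym)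
  also have "\<dots> = (1 + qvar) * (qvar * qint (- qvar) p)" by (simp flip: qint_minus_qvar)
  finally show "qint qvar 2 * (qpochhammer (-1) qvar (p - 1) * qpochhammer (- qvar) qvar (p - 1)) \<approx>
     qint qvar 2 * (qvar * qint (- qvar) p)"
    by (simp add: one_plus_qvar H_def G_def)
qed (use p_gt_2 in \<open>auto intro!: laurent_mult laurent_qpochhammer laurent_qint laurent_uminus\<close>)

section \<open>The surviving summand\<close>

text \<open>
  The summand \<open>k = p - 1\<close>, divided by \<open>[p]\<close> and simplified modulo \<open>[p]\<close> as far as possible
  without knowing the residue of \<open>m\<close>.
\<close>

definition last_term :: "nat \<Rightarrow> int poly fract" where
  "last_term m = qvar powi (1 + int m) * (qvar * qint (- qvar) p) *
      qbinomial qvar (m + (p - 1)) (2 * (p - 1))"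

lemma sum_lcong_last_term:
  "lcong (qint qvar p ^ 2) (\<Sum>k<p. (1 - qvar ^ (2 * k + 1)) / (1 - qvar) * Q.delannoy_product m k /
      qvar ^ k)
     (qint qvar p * last_term m)"
proof -
  define u where "u k = qvar ^ (k\<^sup>2 + Suc k) / qvar ^ (k * m + Suc k * p) * qpochhammer (-1) qvar k *
     qpochhammer (- qvar) qvar k * qbinomial qvar (m + k) (2 * k) * qbinomial qvar (p + k) k" for k
  have powers: "qvar ^ a / qvar ^ b = qvar powi (int a - int b)" for a b
    by (simp add: power_int_diff)
  have u: "u k \<in> laurent_polys" for k
    unfolding u_def powers
    by (intro laurent_mult laurent_powi laurent_qbinomial laurent_qpochhammer laurent_uminus) auto
  have p: "p = Suc (p - 1)" using p_gt_2 by simp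
  have "(\<Sum>k<p. (1 - qvar ^ (2 * k + 1)) / (1 - qvar) * Q.delannoy_product m k / qvar ^ k) =
    (\<Sum>k<p. qint qvar p * (u k * qbinomial qvar p (Suc k)))"
    unfolding Q.weighted_delannoy_sum u_def by (simp add: mult_ac)
  also have "\<dots> = (\<Sum>k<p - 1. qint qvar p * (u k * qbinomial qvar p (Suc k))) + qint qvar p *
      u (p - 1)"
    by (subst p, subst sum.lessThan_Suc) (use p_gt_2 in simp)
  also have "lcong (qint qvar p ^ 2) \<dots> ((\<Sum>k<p - 1. qint qvar p * (u k * 0)) + qint qvar p *
      last_term m)"
  proof (intro lcong_add lcong_sum; rule lcong_square_modulus)
    fix k assume "k \<in> {..<p - 1}"
    then show "u k * qbinomial qvar p (Suc k) \<approx> u k * 0"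
      by (intro lcong_mult_left pcong_qbinomial_p u) auto
  next
    have 1: "qbinomial qvar (p + (p - 1)) (p - 1) \<approx> 1"
      using q_lucas[of "p - 1" "p - 1" 1 0] p_gt_2 by simp
    have "[int ((p - 1)\<^sup>2 + Suc (p - 1)) - int ((p - 1) * m + Suc (p - 1) * p) =
        1 + int m] (mod int p)"
    proof -
      obtain r where r: "p = Suc r" using p by blast
      have "int ((p - 1)\<^sup>2 + Suc (p - 1)) - int ((p - 1) * m + Suc (p - 1) * p) - (1 + int m)
          = int p * (- 1 - int m)"
        unfolding r by (simp add: power2_eq_square algebra_simps)
      then show ?thesis by (simp add: cong_iff_dvd_diff)
    qed
    note 2 = pcong_powi[OF this]
    have "u (p - 1) = qvar powi (int ((p - 1)\<^sup>2 + Suc (p - 1)) -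
        int ((p - 1) * m + Suc (p - 1) * p)) *
      (qpochhammer (-1) qvar (p - 1) * qpochhammer (- qvar) qvar (p - 1)) *
      qbinomial qvar (m + (p - 1)) (2 * (p - 1)) * qbinomial qvar (p + (p - 1)) (p - 1)"
      unfolding u_def powers by (simp only: mult.assoc)
    also have "\<dots> \<approx> last_term m * 1"
      unfolding last_term_def
      by (intro lcong_mult 1 2 pcong_qpochhammer_product lcong_refl laurent_qbinomial)
    finally show "u (p - 1) \<approx> last_term m" by simp
  qed (use u in auto)
  finally show ?thesis by simp
qed

text \<open>
  Both nonzero right-hand sides of the theorem contain this quotient, with \<open>m = p t\<close> or
  \<open>m + 1 = p t\<close>. It splits along
  \<open>1 - q^(2 p t) = (1 - q^p) (1 + q^p) (1 + q^(2 p) + \<dots> + q^(2 p (t-1)))\<close>.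
\<close>

lemma geometric_factor:
  "(1 - qvar ^ (2 * (p * t))) / (1 - qvar ^ 2) =
      qint qvar p * (qint (- qvar) p * qint (qvar ^ (2 * p)) t)"
proof -
  have nontrivial: "qvar ^ (2 * p) \<noteq> 1" using p_gt_2 by (intro Q.q_power_neq_1) linarith
  have "(qvar ^ (2 * p)) ^ t = qvar ^ (2 * (p * t))" by (metis power_mult mult.assoc)
  then have "qint (qvar ^ (2 * p)) t = (1 - qvar ^ (2 * (p * t))) / (1 - qvar ^ (2 * p))"
    using nontrivial unfolding qint_def sum_gp_strict by (simp only: if_False)
  moreover have square: "1 - x ^ 2 = (1 - x) * (1 + x)" for x :: "int poly fract"
    by (simp add: algebra_simps power2_eq_square)
  have "1 - qvar ^ 2 = (1 - qvar) * (1 + qvar)" by (rule square)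
  moreover have "1 - qvar ^ (2 * p) = (1 - qvar ^ p) * (1 + qvar ^ p)"
    using square[of "qvar ^ p"] by (metis mult.commute power_mult)
  moreover have "1 + qvar \<noteq> 0"
  proof
    assume "1 + qvar = 0"
    then have "qvar = -1" by (simp add: eq_neg_iff_add_eq_0 add.commute)
    then have "qvar ^ 2 = 1" by (metis power2_minus one_power2)
    then show False using Q.q_power_neq_1[of 2] by (metis zero_less_numeral)
  qed
  moreover from this have "qint (- qvar) p = (1 + qvar ^ p) / (1 + qvar)"
    using qint_minus_qvar by (simp add: field_simps)
  moreover have "1 - qvar ^ (2 * p) \<noteq> 0"
    using nontrivial by (metis right_minus_eq)
  ultimately show ?thesis by (simp only: Q.qint_eq) (simp add: divide_simps)
qed

lemma pcong_qint_power: "qint (qvar ^ (2 * p)) t \<approx> of_nat t"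
proof -
  have "(qvar ^ (2 * p)) ^ i \<approx> 1 ^ i" for i
    using pcong_qvar_power[of 2 0] by (intro lcong_power) (simp add: mult.commute)
  then have "(\<Sum>i<t. (qvar ^ (2 * p)) ^ i) \<approx> (\<Sum>i<t. 1)"
    by (intro lcong_sum) simp
  then show ?thesis by (simp add: qint_def)
qed

lemma laurent_qint_minus_qvar [intro]: "qint (- qvar) p \<in> laurent_polys"
  by (intro laurent_qint laurent_uminus laurent_qvar)

text \<open>
  Here \<open>m + p - 1 = p t + (p - 1)\<close> and \<open>2 p - 2 = p + (p - 2)\<close>, so the \<open>q\<close>-Lucas theorem gives
  \<open>t [p-1]\<close>, and \<open>q [p-1] = [p] - 1\<close>.
\<close>

lemma last_term_multiple:
  assumes m: "m = p * t"
  shows "last_term m \<approx> (- (qvar powi (1 - 2 * int m))) *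
      (qint (- qvar) p * qint (qvar ^ (2 * p)) t)"
proof -
  have "qbinomial qvar (p - 1) (p - 2) = qint qvar (p - 1)"
    using Q.qbinomial_symmetric[of 1 "p - 1"] qbinomial_absorb[of 0 "p - 2"] p_gt_2
    by (simp add: qint_def numeral_2_eq_2 Suc_diff_Suc)
  moreover have "m + (p - 1) = p * t + (p - 1)" "2 * (p - 1) = p * 1 + (p - 2)"
    using p_gt_2 m by auto
  ultimately have X: "qbinomial qvar (m + (p - 1)) (2 * (p - 1)) \<approx> of_nat t * qint qvar (p - 1)"
    using q_lucas[of "p - 1" "p - 2" t 1] p_gt_2 by simp
  have "qvar * qint qvar (p - 1) - (- 1) = qint qvar p * 1"
    using qint_add[of 1 "p - 1"] p_gt_2 by (simp add: qint_def)
  then have minus1: "qvar * qint qvar (p - 1) \<approx> - 1"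
    unfolding lcong_iff by (auto intro!: laurent_mult laurent_qint laurent_uminus)
  have powi: "qvar powi (1 + int m) \<approx> qvar powi (1 - 2 * int m)"
  proof (rule pcong_powi)
    have "1 + int m - (1 - 2 * int m) = int p * (3 * int t)" by (simp add: m)
    then show "[1 + int m = 1 - 2 * int m] (mod int p)" by (simp add: cong_iff_dvd_diff)
  qed
  have "last_term m \<approx> qvar powi (1 - 2 * int m) * (qvar * qint (- qvar) p) *
      (of_nat t * qint qvar (p - 1))"
    unfolding last_term_def by (intro lcong_mult powi X lcong_refl) auto
  also have "\<dots> = (qvar powi (1 - 2 * int m) * qint (- qvar) p * of_nat t) *
      (qvar * qint qvar (p - 1))"
    by (simp add: mult_ac)
  also have "\<dots> \<approx> (qvar powi (1 - 2 * int m) * qint (- qvar) p * of_nat t) * (- 1)"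
    by (intro lcong_mult_left minus1) auto
  also have "\<dots> = (- (qvar powi (1 - 2 * int m))) * (qint (- qvar) p * of_nat t)" by simp
  also have "\<dots> \<approx> (- (qvar powi (1 - 2 * int m))) * (qint (- qvar) p * qint (qvar ^ (2 * p)) t)"
    by (intro lcong_mult_left lcong_sym[OF pcong_qint_power]) auto
  finally show ?thesis .
qed

text \<open>
  Here \<open>m + p - 1 = p t + (p - 2)\<close>, so the \<open>q\<close>-Lucas theorem gives \<open>t [p-2 choose p-2] = t\<close>.
\<close>

lemma last_term_minus_1:
  assumes m: "Suc m = p * t"
  shows "last_term m \<approx> qvar * (qint (- qvar) p * qint (qvar ^ (2 * p)) t)"
proof -
  have "m + (p - 1) = p * t + (p - 2)" "2 * (p - 1) = p * 1 + (p - 2)"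
    using p_gt_2 m by auto
  then have X: "qbinomial qvar (m + (p - 1)) (2 * (p - 1)) \<approx> of_nat t"
    using q_lucas[of "p - 2" "p - 2" t 1] p_gt_2 by simp
  have powi: "qvar powi (1 + int m) \<approx> qvar powi 0"
  proof (rule pcong_powi)
    have "1 + int m - 0 = int p * int t" using m by (simp flip: of_nat_Suc of_nat_mult)
    then show "[1 + int m = 0] (mod int p)" by (simp add: cong_iff_dvd_diff)
  qed
  have "last_term m \<approx> qvar powi 0 * (qvar * qint (- qvar) p) * of_nat t"
    unfolding last_term_def by (intro lcong_mult powi X lcong_refl) auto
  also have "\<dots> = (qvar * qint (- qvar) p) * of_nat t" by simp
  also have "\<dots> \<approx> (qvar * qint (- qvar) p) * qint (qvar ^ (2 * p)) t"
    by (intro lcong_mult_left lcong_sym[OF pcong_qint_power]) auto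
  finally show ?thesis by (simp only: mult.assoc)
qed

text \<open>
  With \<open>s = m mod p\<close> the upper index \<open>m + p - 1\<close> has last digit \<open>s - 1 < p - 2\<close> in base \<open>p\<close>, so
  the \<open>q\<close>-Lucas theorem gives a multiple of \<open>[s-1 choose p-2] = 0\<close>.
\<close>

lemma last_term_other:
  assumes "m mod p \<noteq> 0" "Suc m mod p \<noteq> 0"
  shows "last_term m \<approx> 0"
proof -
  define s where "s = m mod p"
  have "s < p" unfolding s_def using p_gt_2 by (intro mod_less_divisor) linarith
  moreover have "0 < s" using assms(1) unfolding s_def by blast
  ultimately have s: "0 < s" "s < p" by blast+
  have "s \<noteq> p - 1"
  proof
    assume "s = p - 1"
    then have "Suc (m mod p) = p" using p_gt_2 unfolding s_def by linarith
    then show False using assms(2) by (metis mod_Suc)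
  qed
  then have s': "s - 1 < p - 2" using s by linarith
  have "m = p * (m div p) + s" by (simp add: s_def)
  then have "m + (p - 1) = p * Suc (m div p) + (s - 1)" "2 * (p - 1) = p * 1 + (p - 2)"
    using p_gt_2 s unfolding mult_Suc_right by linarith+
  then have X: "qbinomial qvar (m + (p - 1)) (2 * (p - 1)) \<approx> 0"
    using q_lucas[of "s - 1" "p - 2" "Suc (m div p)" 1] p_gt_2 s s' by simp
  have "last_term m \<approx> qvar powi (1 + int m) * (qvar * qint (- qvar) p) * 0"
    unfolding last_term_def by (intro lcong_mult_left X) auto
  then show ?thesis by simp
qed

end

theorem theorem1p6:
  fixes p m :: nat
  assumes "prime p" and "odd p" and "m > 0"
  shows "laurent_cong
    (\<Sum>k=0..p-1. (1 - qvar ^ (2 * k + 1)) / (1 - qvar)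
        * qdelannoy qvar m k * qdelannoy (inverse qvar) m k * qvar powi (- int k))
    (if [int m = 0] (mod int p) then (1 - qvar powi (- 2 * int m)) / (1 - qvar ^ 2) * qvar
     else if [int m = -1] (mod int p) then (1 - qvar ^ (2 * m + 2)) / (1 - qvar ^ 2) * qvar
     else 0)
    (qint qvar p ^ 2)"
proof -
  let ?R = "if [int m = 0] (mod int p) then (1 - qvar powi (- 2 * int m)) / (1 - qvar ^ 2) * qvar
     else if [int m = -1] (mod int p) then (1 - qvar ^ (2 * m + 2)) / (1 - qvar ^ 2) * qvar
     else 0"
  have p: "p > 0" using assms by (simp add: prime_gt_0_nat)
  have cong_0: "[int m = 0] (mod int p) \<longleftrightarrow> m mod p = 0"
    by (simp add: cong_0_iff mod_eq_0_iff_dvd)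
  have cong_1: "[int m = -1] (mod int p) \<longleftrightarrow> Suc m mod p = 0"
    by (simp add: cong_iff_dvd_diff mod_eq_0_iff_dvd add.commute flip: int_dvd_int_iff)
  have last: "lcong (qint qvar p ^ 2) (qint qvar p * last_term p m) ?R"
  proof -
    consider (zero) t where "m = p * t" | (minus_one) t where "m mod p \<noteq> 0" "Suc m = p * t"
      | (other) "m mod p \<noteq> 0" "Suc m mod p \<noteq> 0"
      by (metis mod_eq_0_iff_dvd dvdE)
    then show ?thesis
    proof cases
      case zero
      then have "[int m = 0] (mod int p)" using cong_0 by (metis mod_mult_self1_is_0)
      then have "?R = (1 - qvar powi (- 2 * int m)) / (1 - qvar ^ 2) * qvar" by (rule if_P)
      also have "\<dots> = (- (qvar powi (1 - 2 * int m))) * ((1 - qvar ^ (2 * m)) / (1 - qvar ^ 2))"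
      proof -
        have "- 2 * int m = - int (2 * m)" by simp
        then have "qvar powi (- 2 * int m) = inverse (qvar ^ (2 * m))"
          by (simp only: power_int_minus power_int_of_nat)
        then have "1 - qvar powi (- 2 * int m) =
            (- (qvar powi (- 2 * int m))) * (1 - qvar ^ (2 * m))"
          by (simp add: right_diff_distrib)
        moreover have "qvar powi (1 - 2 * int m) = qvar powi (- 2 * int m) * qvar"
          using power_int_add[of qvar "- 2 * int m" 1] by simp
        ultimately show ?thesis by (simp only: mult_ac times_divide_eq_right mult_minus_left
            mult_minus_right divide_minus_left)
      qed
      also have "\<dots> = qint qvar p *
          ((- (qvar powi (1 - 2 * int m))) * (qint (- qvar) p * qint (qvar ^ (2 * p)) t))"
        using geometric_factor[OF assms(1,2), of t] unfolding zero by (simp only: mult.left_commute)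
      finally have R: "?R = \<dots>" .
      show ?thesis unfolding R
        by (intro lcong_square_modulus last_term_multiple[OF assms(1,2) zero] laurent_qint
            laurent_qvar)
    next
      case minus_one
      have not_0: "\<not> [int m = 0] (mod int p)" using minus_one(1) unfolding cong_0 .
      have "[int m = -1] (mod int p)" using minus_one(2) cong_1 by (metis mod_mult_self1_is_0)
      then have "?R = (1 - qvar ^ (2 * m + 2)) / (1 - qvar ^ 2) * qvar"
        by (simp only: not_0 if_False if_True)
      also have "\<dots> = qint qvar p * (qvar * (qint (- qvar) p * qint (qvar ^ (2 * p)) t))"
      proof -
        have "2 * m + 2 = 2 * (p * t)" using minus_one(2) by simp
        then show ?thesis
          using geometric_factor[OF assms(1,2), of t] by (simp only: mult_ac)
      qed
      finally have R: "?R = \<dots>" .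
      show ?thesis unfolding R
        by (intro lcong_square_modulus last_term_minus_1[OF assms(1,2) minus_one(2)] laurent_qint
            laurent_qvar)
    next
      case other
      then have R: "?R = qint qvar p * 0" unfolding cong_0 cong_1 by simp
      show ?thesis unfolding R
        by (intro lcong_square_modulus last_term_other[OF assms(1,2) other] laurent_qint
            laurent_qvar)
    qed
  qed
  have sum_eq: "(\<Sum>k=0..p-1. (1 - qvar ^ (2 * k + 1)) / (1 - qvar)
        * qdelannoy qvar m k * qdelannoy (inverse qvar) m k * qvar powi (- int k)) =
     (\<Sum>k<p. (1 - qvar ^ (2 * k + 1)) / (1 - qvar) * Q.delannoy_product m k / qvar ^ k)"
    using p by (intro sum.cong) (auto simp: Q.delannoy_product_def power_int_minus divide_inverse)
  show ?thesis unfolding sum_eq lcong_def[symmetric]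
    by (rule lcong_trans[OF sum_lcong_last_term[OF assms(1,2)] last])
qed

end
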